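(* Let $\Omega\subset\mathbb{R}^n$ be such that the embedding $W^{1,2}(\Omega)\subset L^2(\Omega)$ is compact, $X=Y=L^2(\Omega)$, let $T\colon L^2(\Omega)\times X\to Y$ be a continuous bilinear operator, $f\in W^{1,2}(\Omega)$, $\alpha,\beta>0$, and let $R\colon X\to[0,\infty]$ be a strongly convex, coercive and weakly lower semicontinuous functional with $R\not\equiv\infty$. Let $(y_k)\subset Y$ be a convergent sequence with $y_k\to\hat y$ and let $(g_k)\subset W^{1,2}(\Omega)$ be corresponding solutions of the parametrized ADP-$\beta$ problem with data $y_k$. Then $(g_k)$ has a subsequence converging (in norm) in $W^{1,2}(\Omega)$, and the limit of each convergent subsequence is a solution of the parametrized ADP-$\beta$ problem with data $\hat y$.
   Context: For data $y\in Y$, the parametrized ADP-$\beta$ problem (with $p=2$) is $$\min_{g\in W^{1,2}(\Omega)}\ \frac12\|T(f,x_g)-y\|_{L^2}^2+\beta\|f-g\|_{W^{1,2}}^2\quad\text{s.t.}\quad x_g=\arg\min_{x\in L^2(\Omega)}\ \frac12\|T(g,x)-y\|_{L^2}^2+\alpha R(x).$$ The inner minimizer $x_g$ is unique since $R$ is strongly convex, and it depends on $g$ and on the data $y$. A solution for data $y$ is a $g\in W^{1,2}(\Omega)$ attaining the outer minimum. The forward operator of the underlying inverse problem is $Ax=T(f,x)$. *)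

theory Defs
  imports "HOL-Analysis.Analysis"
begin

text \<open>
  Elements of \<open>L\<^sup>2(\<Omega>)\<close> and \<open>W\<^bsup>1,2\<^esup>(\<Omega>)\<close> are represented by functions; their values outside \<open>\<Omega>\<close> are
  irrelevant. Equality of the underlying classes is equality almost everywhere on \<open>\<Omega>\<close>, the norms
  are seminorms on representatives, and operators on the spaces are only required to satisfy their
  algebraic laws up to almost everywhere equality.
\<close>

definition L2 :: "'a::euclidean_space set \<Rightarrow> ('a \<Rightarrow> real) set" where
  "L2 \<Omega> = {u \<in> borel_measurable (lebesgue_on \<Omega>). integrable (lebesgue_on \<Omega>) (\<lambda>s. (u s)\<^sup>2)}"

definition L2_norm :: "'a::euclidean_space set \<Rightarrow> ('a \<Rightarrow> real) \<Rightarrow> real" where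
  "L2_norm \<Omega> u = sqrt (\<integral>s. (u s)\<^sup>2 \<partial>lebesgue_on \<Omega>)"

definition eq_AE :: "'a::euclidean_space set \<Rightarrow> ('a \<Rightarrow> real) \<Rightarrow> ('a \<Rightarrow> real) \<Rightarrow> bool" where
  "eq_AE \<Omega> u v \<longleftrightarrow> (AE s in lebesgue_on \<Omega>. u s = v s)"

definition L2_tendsto :: "'a::euclidean_space set \<Rightarrow> (nat \<Rightarrow> 'a \<Rightarrow> real) \<Rightarrow> ('a \<Rightarrow> real) \<Rightarrow> bool" where
  "L2_tendsto \<Omega> u v \<longleftrightarrow> (\<lambda>k. L2_norm \<Omega> (\<lambda>s. u k s - v s)) \<longlonglongrightarrow> 0"


fun C_k :: "nat \<Rightarrow> ('a::euclidean_space \<Rightarrow> real) \<Rightarrow> bool" where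
  "C_k 0 \<phi> \<longleftrightarrow> continuous_on UNIV \<phi>"
| "C_k (Suc k) \<phi> \<longleftrightarrow> (\<forall>s. \<phi> differentiable (at s)) \<and>
     (\<forall>i\<in>Basis. C_k k (\<lambda>s. frechet_derivative \<phi> (at s) i))"

definition test_function :: "'a::euclidean_space set \<Rightarrow> ('a \<Rightarrow> real) \<Rightarrow> bool" where
  "test_function \<Omega> \<phi> \<longleftrightarrow>
     (\<forall>k. C_k k \<phi>) \<and> compact (closure {s. \<phi> s \<noteq> 0}) \<and> closure {s. \<phi> s \<noteq> 0} \<subseteq> \<Omega>"

definition is_weak_partial ::
  "'a::euclidean_space set \<Rightarrow> 'a \<Rightarrow> ('a \<Rightarrow> real) \<Rightarrow> ('a \<Rightarrow> real) \<Rightarrow> bool" where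
  "is_weak_partial \<Omega> i u w \<longleftrightarrow>
     (\<forall>\<phi>. test_function \<Omega> \<phi> \<longrightarrow>
        (\<integral>s. u s * frechet_derivative \<phi> (at s) i \<partial>lebesgue_on \<Omega>)
          = - (\<integral>s. w s * \<phi> s \<partial>lebesgue_on \<Omega>))"

definition W12 :: "'a::euclidean_space set \<Rightarrow> ('a \<Rightarrow> real) set" where
  "W12 \<Omega> = {u \<in> L2 \<Omega>. \<forall>i\<in>Basis. \<exists>w\<in>L2 \<Omega>. is_weak_partial \<Omega> i u w}"

text \<open>Weak derivatives are unique up to null sets, so the choice below is immaterial.\<close>

definition weak_partial :: "'a::euclidean_space set \<Rightarrow> 'a \<Rightarrow> ('a \<Rightarrow> real) \<Rightarrow> 'a \<Rightarrow> real" where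
  "weak_partial \<Omega> i u = (SOME w. w \<in> L2 \<Omega> \<and> is_weak_partial \<Omega> i u w)"

definition W12_norm :: "'a::euclidean_space set \<Rightarrow> ('a \<Rightarrow> real) \<Rightarrow> real" where
  "W12_norm \<Omega> u =
     sqrt ((L2_norm \<Omega> u)\<^sup>2 + (\<Sum>i\<in>Basis. (L2_norm \<Omega> (weak_partial \<Omega> i u))\<^sup>2))"

definition W12_tendsto :: "'a::euclidean_space set \<Rightarrow> (nat \<Rightarrow> 'a \<Rightarrow> real) \<Rightarrow> ('a \<Rightarrow> real) \<Rightarrow> bool" where
  "W12_tendsto \<Omega> u v \<longleftrightarrow> (\<lambda>k. W12_norm \<Omega> (\<lambda>s. u k s - v s)) \<longlonglongrightarrow> 0"

definition compact_embedding_W12_L2 :: "'a::euclidean_space set \<Rightarrow> bool" where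
  "compact_embedding_W12_L2 \<Omega> \<longleftrightarrow>
     (\<forall>u :: nat \<Rightarrow> 'a \<Rightarrow> real.
        (\<forall>k. u k \<in> W12 \<Omega>) \<and> bounded (range (\<lambda>k. W12_norm \<Omega> (u k))) \<longrightarrow>
        (\<exists>r v. strict_mono r \<and> v \<in> L2 \<Omega> \<and> L2_tendsto \<Omega> (\<lambda>k. u (r k)) v))"


text \<open>
  The counterpart of \<^locale>\<open>bounded_bilinear\<close> for \<open>T : L\<^sup>2(\<Omega>) \<times> L\<^sup>2(\<Omega>) \<rightarrow> L\<^sup>2(\<Omega>)\<close>. Together with
  bilinearity, boundedness implies that \<open>T\<close> respects almost everywhere equality.
\<close>

definition L2_bounded_bilinear ::
  "'a::euclidean_space set \<Rightarrow> (('a \<Rightarrow> real) \<Rightarrow> ('a \<Rightarrow> real) \<Rightarrow> ('a \<Rightarrow> real)) \<Rightarrow> bool" where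
  "L2_bounded_bilinear \<Omega> T \<longleftrightarrow>
     (\<forall>g\<in>L2 \<Omega>. \<forall>x\<in>L2 \<Omega>. T g x \<in> L2 \<Omega>) \<and>
     (\<forall>g\<in>L2 \<Omega>. \<forall>h\<in>L2 \<Omega>. \<forall>x\<in>L2 \<Omega>.
        eq_AE \<Omega> (T (\<lambda>s. g s + h s) x) (\<lambda>s. T g x s + T h x s)) \<and>
     (\<forall>g\<in>L2 \<Omega>. \<forall>x\<in>L2 \<Omega>. \<forall>z\<in>L2 \<Omega>.
        eq_AE \<Omega> (T g (\<lambda>s. x s + z s)) (\<lambda>s. T g x s + T g z s)) \<and>
     (\<forall>c. \<forall>g\<in>L2 \<Omega>. \<forall>x\<in>L2 \<Omega>. eq_AE \<Omega> (T (\<lambda>s. c * g s) x) (\<lambda>s. c * T g x s)) \<and>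
     (\<forall>c. \<forall>g\<in>L2 \<Omega>. \<forall>x\<in>L2 \<Omega>. eq_AE \<Omega> (T g (\<lambda>s. c * x s)) (\<lambda>s. c * T g x s)) \<and>
     (\<exists>C. \<forall>g\<in>L2 \<Omega>. \<forall>x\<in>L2 \<Omega>. L2_norm \<Omega> (T g x) \<le> C * L2_norm \<Omega> g * L2_norm \<Omega> x)"

definition L2_bounded_functional ::
  "'a::euclidean_space set \<Rightarrow> (('a \<Rightarrow> real) \<Rightarrow> real) \<Rightarrow> bool" where
  "L2_bounded_functional \<Omega> F \<longleftrightarrow>
     (\<forall>u\<in>L2 \<Omega>. \<forall>v\<in>L2 \<Omega>. F (\<lambda>s. u s + v s) = F u + F v) \<and>
     (\<forall>c. \<forall>u\<in>L2 \<Omega>. F (\<lambda>s. c * u s) = c * F u) \<and>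
     (\<exists>C. \<forall>u\<in>L2 \<Omega>. \<bar>F u\<bar> \<le> C * L2_norm \<Omega> u)"

definition L2_weakly_tendsto ::
  "'a::euclidean_space set \<Rightarrow> (nat \<Rightarrow> 'a \<Rightarrow> real) \<Rightarrow> ('a \<Rightarrow> real) \<Rightarrow> bool" where
  "L2_weakly_tendsto \<Omega> u v \<longleftrightarrow>
     (\<forall>F. L2_bounded_functional \<Omega> F \<longrightarrow> (\<lambda>k. F (u k)) \<longlonglongrightarrow> F v)"

text \<open>
  A map on functions that is a functional on \<open>L\<^sup>2(\<Omega>)\<close>, i.e. independent of the representative.
\<close>

definition L2_functional ::
  "'a::euclidean_space set \<Rightarrow> (('a \<Rightarrow> real) \<Rightarrow> ennreal) \<Rightarrow> bool" where
  "L2_functional \<Omega> R \<longleftrightarrow> (\<forall>u\<in>L2 \<Omega>. \<forall>v\<in>L2 \<Omega>. eq_AE \<Omega> u v \<longrightarrow> R u = R v)"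

definition L2_strongly_convex ::
  "'a::euclidean_space set \<Rightarrow> (('a \<Rightarrow> real) \<Rightarrow> ennreal) \<Rightarrow> bool" where
  "L2_strongly_convex \<Omega> R \<longleftrightarrow>
     (\<exists>m>0. \<forall>u\<in>L2 \<Omega>. \<forall>v\<in>L2 \<Omega>. \<forall>t\<in>{0<..<1}.
        R (\<lambda>s. t * u s + (1 - t) * v s)
          + ennreal (m / 2 * t * (1 - t) * (L2_norm \<Omega> (\<lambda>s. u s - v s))\<^sup>2)
        \<le> ennreal t * R u + ennreal (1 - t) * R v)"

definition L2_coercive ::
  "'a::euclidean_space set \<Rightarrow> (('a \<Rightarrow> real) \<Rightarrow> ennreal) \<Rightarrow> bool" where
  "L2_coercive \<Omega> R \<longleftrightarrow>
     (\<forall>M::real. \<exists>r. \<forall>u\<in>L2 \<Omega>. L2_norm \<Omega> u \<ge> r \<longrightarrow> R u \<ge> ennreal M)"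

text \<open>
  Sequential weak lower semicontinuity; for convex functionals this agrees with lower
  semicontinuity in the weak topology.
\<close>

definition L2_weakly_lsc ::
  "'a::euclidean_space set \<Rightarrow> (('a \<Rightarrow> real) \<Rightarrow> ennreal) \<Rightarrow> bool" where
  "L2_weakly_lsc \<Omega> R \<longleftrightarrow>
     (\<forall>u v. (\<forall>k. u k \<in> L2 \<Omega>) \<and> v \<in> L2 \<Omega> \<and> L2_weakly_tendsto \<Omega> u v \<longrightarrow>
        R v \<le> liminf (\<lambda>k. R (u k)))"


definition inner_objective ::
  "'a::euclidean_space set \<Rightarrow> (('a \<Rightarrow> real) \<Rightarrow> ('a \<Rightarrow> real) \<Rightarrow> ('a \<Rightarrow> real)) \<Rightarrow>
   (('a \<Rightarrow> real) \<Rightarrow> ennreal) \<Rightarrow> real \<Rightarrow> ('a \<Rightarrow> real) \<Rightarrow> ('a \<Rightarrow> real) \<Rightarrow> ('a \<Rightarrow> real) \<Rightarrow> ennreal" where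
  "inner_objective \<Omega> T R \<alpha> y g x =
     ennreal (1 / 2 * (L2_norm \<Omega> (\<lambda>s. T g x s - y s))\<^sup>2) + ennreal \<alpha> * R x"

text \<open>
  \<^const>\<open>arg_min\<close> selects some minimizer. If \<open>R\<close> is strongly convex, weakly lower semicontinuous
  and not identically infinite, a minimizer exists and is unique up to almost everywhere equality.
\<close>

definition inner_minimizer ::
  "'a::euclidean_space set \<Rightarrow> (('a \<Rightarrow> real) \<Rightarrow> ('a \<Rightarrow> real) \<Rightarrow> ('a \<Rightarrow> real)) \<Rightarrow>
   (('a \<Rightarrow> real) \<Rightarrow> ennreal) \<Rightarrow> real \<Rightarrow> ('a \<Rightarrow> real) \<Rightarrow> ('a \<Rightarrow> real) \<Rightarrow> ('a \<Rightarrow> real)" where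
  "inner_minimizer \<Omega> T R \<alpha> y g = arg_min (inner_objective \<Omega> T R \<alpha> y g) (\<lambda>x. x \<in> L2 \<Omega>)"

definition outer_objective ::
  "'a::euclidean_space set \<Rightarrow> (('a \<Rightarrow> real) \<Rightarrow> ('a \<Rightarrow> real) \<Rightarrow> ('a \<Rightarrow> real)) \<Rightarrow>
   (('a \<Rightarrow> real) \<Rightarrow> ennreal) \<Rightarrow> real \<Rightarrow> real \<Rightarrow> ('a \<Rightarrow> real) \<Rightarrow> ('a \<Rightarrow> real) \<Rightarrow> ('a \<Rightarrow> real) \<Rightarrow> real" where
  "outer_objective \<Omega> T R \<alpha> \<beta> f y g =
     1 / 2 * (L2_norm \<Omega> (\<lambda>s. T f (inner_minimizer \<Omega> T R \<alpha> y g) s - y s))\<^sup>2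
       + \<beta> * (W12_norm \<Omega> (\<lambda>s. f s - g s))\<^sup>2"

definition ADP_solution ::
  "'a::euclidean_space set \<Rightarrow> (('a \<Rightarrow> real) \<Rightarrow> ('a \<Rightarrow> real) \<Rightarrow> ('a \<Rightarrow> real)) \<Rightarrow>
   (('a \<Rightarrow> real) \<Rightarrow> ennreal) \<Rightarrow> real \<Rightarrow> real \<Rightarrow> ('a \<Rightarrow> real) \<Rightarrow> ('a \<Rightarrow> real) \<Rightarrow> ('a \<Rightarrow> real) \<Rightarrow> bool" where
  "ADP_solution \<Omega> T R \<alpha> \<beta> f y g \<longleftrightarrow>
     is_arg_min (outer_objective \<Omega> T R \<alpha> \<beta> f y) (\<lambda>g. g \<in> W12 \<Omega>) g"

end

theory Submission
  imports Defs
begin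

text \<open>
  The compact embedding yields convergence in \<open>L\<^sup>2\<close> of a subsequence; all further convergence comes from
  comparing minimizers with midpoints, by parallelogram identities and strong convexity, and no weak
  compactness is used.

  \<^emph>\<open>Inner problem.\<close> By strong convexity, minimizing sequences of the inner objective are Cauchy in
  \<open>L\<^sup>2\<close>, so minimizers exist (\<open>real_objective_minimizer_exists\<close>), and the objective grows
  quadratically away from its minimizer (\<open>quadratic_growth\<close>). Let \<open>x\<^sub>i\<close> and \<open>x\<close> be the minimizers for
  \<open>(y\<^sub>i, g\<^sub>i)\<close> and \<open>(y, g)\<close>, where \<open>y\<^sub>i \<rightarrow> y\<close> and \<open>g\<^sub>i \<rightarrow> g\<close> in \<open>L\<^sup>2\<close>. Adding the two growth inequalities
  cancels \<open>R\<close> and bounds \<open>\<parallel>x\<^sub>i - x\<parallel>\<^sup>2\<close> by differences of data fits, which tend to zero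
  (\<open>inner_minimizer_stable\<close>). So the outer data fit \<open>E(y, g) = 1/2 \<parallel>T f x\<^sub>g - y\<parallel>\<^sup>2\<close> is continuous for the
  \<open>L\<^sup>2\<close> norms of \<open>y\<close> and \<open>g\<close>.

  \<^emph>\<open>Outer problem.\<close> Let \<open>y\<^sub>k \<rightarrow> y\<close> with solutions \<open>g\<^sub>k\<close>. Comparison with the competitor \<open>f\<close> bounds \<open>(g\<^sub>k)\<close> in \<open>W\<^bsup>1,2\<^esup>\<close>, and the compact
  embedding gives a subsequence converging in \<open>L\<^sup>2\<close> to some \<open>v\<close>. Testing the optimality of \<open>g\<^sub>k\<close> and
  \<open>g\<^sub>l\<close> with their midpoint \<open>h\<close> and using the parallelogram law in \<open>W\<^bsup>1,2\<^esup>\<close> gives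
  \<open>\<beta>/2 \<parallel>g\<^sub>k - g\<^sub>l\<parallel>\<^sup>2 \<le> (E(y\<^sub>k, h) - E(y\<^sub>k, g\<^sub>k)) + (E(y\<^sub>l, h) - E(y\<^sub>l, g\<^sub>l))\<close> (\<open>ADP_solutions_midpoint\<close>). All
  four terms on the right converge to \<open>E(y, v)\<close>, so the subsequence is Cauchy in \<open>W\<^bsup>1,2\<^esup>\<close>, which is
  complete. That limits are solutions follows by passing to the limit in the optimality inequality.

  Weak derivatives are chosen arbitrarily, so even the linearity of weak differentiation, and with it
  the parallelogram law in \<open>W\<^bsup>1,2\<^esup>\<close>, needs their uniqueness almost everywhere, that is, the fundamental
  lemma of the calculus of variations (\<open>fundamental_lemma\<close>). It is proved with explicit smooth bump
  functions built from \<open>exp(-1/t)\<close>.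
\<close>

section \<open>The seminormed space of square integrable functions\<close>

lemma L2_D:
  assumes "u \<in> L2 \<Omega>"
  shows "u \<in> borel_measurable (lebesgue_on \<Omega>)" "integrable (lebesgue_on \<Omega>) (\<lambda>s. (u s)\<^sup>2)"
  using assms by (auto simp: L2_def)

lemma L2_mult_integrable:
  assumes "u \<in> L2 \<Omega>" "v \<in> L2 \<Omega>"
  shows "integrable (lebesgue_on \<Omega>) (\<lambda>s. u s * v s)"
proof (rule Bochner_Integration.integrable_bound)
  note [measurable] = L2_D(1)[OF assms(1)] L2_D(1)[OF assms(2)]
  show "integrable (lebesgue_on \<Omega>) (\<lambda>s. (u s)\<^sup>2 + (v s)\<^sup>2)"
    using L2_D(2)[OF assms(1)] L2_D(2)[OF assms(2)] by simp
  show "(\<lambda>s. u s * v s) \<in> borel_measurable (lebesgue_on \<Omega>)" by measurable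
  have "\<bar>a * b\<bar> \<le> a\<^sup>2 + b\<^sup>2" for a b :: real
  proof -
    have "2 * \<bar>a\<bar> * \<bar>b\<bar> \<le> a\<^sup>2 + b\<^sup>2"
      using sum_squares_bound[of "\<bar>a\<bar>" "\<bar>b\<bar>"] by simp
    moreover have "0 \<le> \<bar>a\<bar> * \<bar>b\<bar>" by simp
    ultimately show ?thesis unfolding abs_mult by linarith
  qed
  then show "AE s in lebesgue_on \<Omega>. norm (u s * v s) \<le> norm ((u s)\<^sup>2 + (v s)\<^sup>2)"
    by auto
qed

lemma L2_lincomb:
  assumes "u \<in> L2 \<Omega>" "v \<in> L2 \<Omega>"
  shows "(\<lambda>s. a * u s + b * v s) \<in> L2 \<Omega>"
proof -
  note [measurable] = L2_D(1)[OF assms(1)] L2_D(1)[OF assms(2)]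
  have "integrable (lebesgue_on \<Omega>) (\<lambda>s. a\<^sup>2 * (u s)\<^sup>2 + 2 * a * b * (u s * v s) + b\<^sup>2 * (v s)\<^sup>2)"
    using L2_D(2)[OF assms(1)] L2_D(2)[OF assms(2)] L2_mult_integrable[OF assms] by auto
  then show ?thesis
    by (auto simp: L2_def power2_eq_square algebra_simps)
qed

lemma L2_diff: "u \<in> L2 \<Omega> \<Longrightarrow> v \<in> L2 \<Omega> \<Longrightarrow> (\<lambda>s. u s - v s) \<in> L2 \<Omega>"
  using L2_lincomb[of u \<Omega> v 1 "-1"] by simp

lemma L2_cmult: "u \<in> L2 \<Omega> \<Longrightarrow> (\<lambda>s. c * u s) \<in> L2 \<Omega>"
  using L2_lincomb[of u \<Omega> u c 0] by simp

lemma L2_zero: "(\<lambda>s. 0) \<in> L2 \<Omega>"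
  by (simp add: L2_def)

lemma L2_norm_nonneg: "0 \<le> L2_norm \<Omega> u"
  by (simp add: L2_norm_def integral_nonneg_AE)

lemma L2_norm_sq: "(L2_norm \<Omega> u)\<^sup>2 = (\<integral>s. (u s)\<^sup>2 \<partial>lebesgue_on \<Omega>)"
  by (simp add: L2_norm_def integral_nonneg_AE)

lemma L2_norm_cmult: "L2_norm \<Omega> (\<lambda>s. c * u s) = \<bar>c\<bar> * L2_norm \<Omega> u"
  by (simp add: L2_norm_def power_mult_distrib real_sqrt_mult)

lemma L2_norm_minus_commute: "L2_norm \<Omega> (\<lambda>s. u s - v s) = L2_norm \<Omega> (\<lambda>s. v s - u s)"
  by (simp add: L2_norm_def power2_commute)

lemma L2_norm_zero [simp]: "L2_norm \<Omega> (\<lambda>s. 0) = 0"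
  by (simp add: L2_norm_def)

lemma L2_norm_lincomb_sq:
  assumes "u \<in> L2 \<Omega>" "v \<in> L2 \<Omega>"
  shows "(L2_norm \<Omega> (\<lambda>s. a * u s + b * v s))\<^sup>2 =
    a\<^sup>2 * (L2_norm \<Omega> u)\<^sup>2 + 2 * a * b * (\<integral>s. u s * v s \<partial>lebesgue_on \<Omega>) + b\<^sup>2 * (L2_norm \<Omega> v)\<^sup>2"
proof -
  have "(\<integral>s. (a * u s + b * v s)\<^sup>2 \<partial>lebesgue_on \<Omega>) =
    (\<integral>s. a\<^sup>2 * (u s)\<^sup>2 + 2 * a * b * (u s * v s) + b\<^sup>2 * (v s)\<^sup>2 \<partial>lebesgue_on \<Omega>)"
    by (simp add: power2_eq_square algebra_simps)
  then show ?thesis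
    using L2_D(2)[OF assms(1)] L2_D(2)[OF assms(2)] L2_mult_integrable[OF assms]
    by (simp add: L2_norm_sq)
qed

lemma L2_Cauchy_Schwarz:
  assumes "u \<in> L2 \<Omega>" "v \<in> L2 \<Omega>"
  shows "\<bar>\<integral>s. u s * v s \<partial>lebesgue_on \<Omega>\<bar> \<le> L2_norm \<Omega> u * L2_norm \<Omega> v"
proof -
  define U V I where "U = L2_norm \<Omega> u" and "V = L2_norm \<Omega> v" and "I = (\<integral>s. u s * v s \<partial>lebesgue_on \<Omega>)"
  have UV: "U \<ge> 0" "V \<ge> 0" by (simp_all add: U_def V_def L2_norm_nonneg)
  have q: "0 \<le> a\<^sup>2 * U\<^sup>2 + 2 * a * b * I + b\<^sup>2 * V\<^sup>2" for a b
    using L2_norm_lincomb_sq[OF assms, of a b] by (metis I_def U_def V_def zero_le_power2)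
  have "I\<^sup>2 \<le> U\<^sup>2 * V\<^sup>2"
  proof (cases "V = 0")
    case True
    have "I = 0"
    proof (rule ccontr)
      assume "I \<noteq> 0"
      then have "U\<^sup>2 + 2 * (- (U\<^sup>2 + 1) / (2 * I)) * I = - 1" by (simp add: field_simps)
      then show False using q[of 1 "- (U\<^sup>2 + 1) / (2 * I)"] True by simp
    qed
    then show ?thesis using True by simp
  next
    case False
    have "0 \<le> V\<^sup>2 * (V\<^sup>2 * U\<^sup>2 - I\<^sup>2)"
      using q[of "V\<^sup>2" "- I"] by (simp add: power2_eq_square algebra_simps)
    then show ?thesis using False by (simp add: zero_le_mult_iff mult.commute)
  qed
  then have "\<bar>I\<bar> \<le> U * V"
    using UV by (metis abs_le_square_iff abs_of_nonneg mult_nonneg_nonneg power_mult_distrib)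
  then show ?thesis by (simp add: U_def V_def I_def)
qed

lemma L2_norm_triangle:
  assumes "u \<in> L2 \<Omega>" "v \<in> L2 \<Omega>"
  shows "L2_norm \<Omega> (\<lambda>s. u s + v s) \<le> L2_norm \<Omega> u + L2_norm \<Omega> v"
proof (rule power2_le_imp_le)
  show "(L2_norm \<Omega> (\<lambda>s. u s + v s))\<^sup>2 \<le> (L2_norm \<Omega> u + L2_norm \<Omega> v)\<^sup>2"
    using L2_norm_lincomb_sq[OF assms, of 1 1] L2_Cauchy_Schwarz[OF assms]
    unfolding power2_sum by simp
  show "0 \<le> L2_norm \<Omega> u + L2_norm \<Omega> v" by (simp add: L2_norm_nonneg)
qed

lemma L2_norm_triangle_diff:
  assumes "u \<in> L2 \<Omega>" "v \<in> L2 \<Omega>" "w \<in> L2 \<Omega>"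
  shows "L2_norm \<Omega> (\<lambda>s. u s - w s) \<le> L2_norm \<Omega> (\<lambda>s. u s - v s) + L2_norm \<Omega> (\<lambda>s. v s - w s)"
  using L2_norm_triangle[OF L2_diff[OF assms(1,2)] L2_diff[OF assms(2,3)]] by simp

lemma L2_norm_diff_ineq:
  assumes "u \<in> L2 \<Omega>" "v \<in> L2 \<Omega>"
  shows "\<bar>L2_norm \<Omega> u - L2_norm \<Omega> v\<bar> \<le> L2_norm \<Omega> (\<lambda>s. u s - v s)"
  using L2_norm_triangle_diff[OF assms L2_zero] L2_norm_triangle_diff[OF assms(2,1) L2_zero]
    L2_norm_minus_commute[of \<Omega> u v] by simp

lemma L2_norm_le_norm_diff:
  assumes "u \<in> L2 \<Omega>" "v \<in> L2 \<Omega>"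
  shows "L2_norm \<Omega> u \<le> L2_norm \<Omega> v + L2_norm \<Omega> (\<lambda>s. u s - v s)"
  using L2_norm_diff_ineq[OF assms] by linarith

lemma L2_norm_diff_le_add:
  assumes "u \<in> L2 \<Omega>" "v \<in> L2 \<Omega>"
  shows "L2_norm \<Omega> (\<lambda>s. u s - v s) \<le> L2_norm \<Omega> u + L2_norm \<Omega> v"
  using L2_norm_triangle_diff[OF assms(1) L2_zero assms(2)] L2_norm_minus_commute[of \<Omega> "\<lambda>s. 0" v] by simp

lemma L2_parallelogram:
  assumes "u \<in> L2 \<Omega>" "v \<in> L2 \<Omega>"
  shows "(L2_norm \<Omega> (\<lambda>s. 1/2 * u s + 1/2 * v s))\<^sup>2 =
    1/2 * (L2_norm \<Omega> u)\<^sup>2 + 1/2 * (L2_norm \<Omega> v)\<^sup>2 - 1/4 * (L2_norm \<Omega> (\<lambda>s. u s - v s))\<^sup>2"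
  using L2_norm_lincomb_sq[OF assms, of "1/2" "1/2"] L2_norm_lincomb_sq[OF assms, of 1 "-1"]
  by (simp add: power2_eq_square field_simps)

lemma eq_AE_sym: "eq_AE \<Omega> u v \<Longrightarrow> eq_AE \<Omega> v u"
  unfolding eq_AE_def by (erule eventually_mono) simp

lemma L2_norm_cong_AE:
  assumes "eq_AE \<Omega> u v" "u \<in> L2 \<Omega>" "v \<in> L2 \<Omega>"
  shows "L2_norm \<Omega> u = L2_norm \<Omega> v"
proof -
  note [measurable] = L2_D(1)[OF assms(2)] L2_D(1)[OF assms(3)]
  have "(\<integral>s. (u s)\<^sup>2 \<partial>lebesgue_on \<Omega>) = (\<integral>s. (v s)\<^sup>2 \<partial>lebesgue_on \<Omega>)"
    using assms(1) by (intro integral_cong_AE) (auto simp: eq_AE_def elim!: eventually_mono)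
  then show ?thesis by (simp add: L2_norm_def)
qed

lemma L2_nn_integral:
  assumes "u \<in> L2 \<Omega>"
  shows "(\<integral>\<^sup>+ s. ennreal ((u s)\<^sup>2) \<partial>lebesgue_on \<Omega>) = ennreal ((L2_norm \<Omega> u)\<^sup>2)"
  using L2_D(2)[OF assms] by (simp add: L2_norm_sq nn_integral_eq_integral)

text \<open>Fatou's lemma controls the \<open>L\<^sup>2\<close> distance to an almost everywhere limit.\<close>

lemma L2_Fatou:
  assumes u: "\<And>k. u k \<in> L2 \<Omega>" and v: "v \<in> borel_measurable (lebesgue_on \<Omega>)"
    and lim: "AE s in lebesgue_on \<Omega>. (\<lambda>k. u k s) \<longlonglongrightarrow> v s"
    and bound: "\<forall>\<^sub>F k in sequentially. L2_norm \<Omega> (u k) \<le> B" and B: "B \<ge> 0"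
  shows "v \<in> L2 \<Omega>" "L2_norm \<Omega> v \<le> B"
proof -
  note [measurable] = v L2_D(1)[OF u]
  have "(\<integral>\<^sup>+ s. ennreal ((v s)\<^sup>2) \<partial>lebesgue_on \<Omega>) =
      (\<integral>\<^sup>+ s. liminf (\<lambda>k. ennreal ((u k s)\<^sup>2)) \<partial>lebesgue_on \<Omega>)"
  proof (rule nn_integral_cong_AE, use lim in eventually_elim)
    case (elim s)
    then have "(\<lambda>k. ennreal ((u k s)\<^sup>2)) \<longlonglongrightarrow> ennreal ((v s)\<^sup>2)"
      by (intro tendsto_intros)
    then show ?case by (rule lim_imp_Liminf[OF sequentially_bot, symmetric])
  qed
  also have "\<dots> \<le> liminf (\<lambda>k. \<integral>\<^sup>+ s. ennreal ((u k s)\<^sup>2) \<partial>lebesgue_on \<Omega>)"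
    by (rule nn_integral_liminf) measurable
  also have "\<dots> = liminf (\<lambda>k. ennreal ((L2_norm \<Omega> (u k))\<^sup>2))"
    by (simp add: L2_nn_integral[OF u])
  also have "\<dots> \<le> limsup (\<lambda>k. ennreal ((L2_norm \<Omega> (u k))\<^sup>2))"
    by (rule Liminf_le_Limsup) simp
  also have "\<dots> \<le> ennreal (B\<^sup>2)"
    using bound by (intro Limsup_bounded)
      (auto elim!: eventually_mono intro!: ennreal_leI power_mono simp: L2_norm_nonneg)
  finally have le: "(\<integral>\<^sup>+ s. ennreal ((v s)\<^sup>2) \<partial>lebesgue_on \<Omega>) \<le> ennreal (B\<^sup>2)" .
  then have "integrable (lebesgue_on \<Omega>) (\<lambda>s. (v s)\<^sup>2)"
    by (intro integrableI_bounded) (auto simp: le_less_trans)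
  then show vL: "v \<in> L2 \<Omega>" using v by (simp add: L2_def)
  show "L2_norm \<Omega> v \<le> B"
    using le B by (simp add: L2_nn_integral[OF vL] abs_le_square_iff[symmetric] L2_norm_nonneg)
qed

text \<open>Riesz--Fischer for a fast Cauchy sequence: almost everywhere, consecutive terms differ by
  \<open>O(2\<^sup>-\<^sup>k)\<close>.\<close>

lemma L2_fast_Cauchy_AE:
  assumes u: "\<And>k. u k \<in> L2 \<Omega>"
    and fast: "\<And>k. (L2_norm \<Omega> (\<lambda>s. u (Suc k) s - u k s))\<^sup>2 \<le> (1/8) ^ k"
  shows "AE s in lebesgue_on \<Omega>. convergent (\<lambda>k. u k s)"
proof -
  note [measurable] = L2_D(1)[OF u]
  let ?q = "\<lambda>k s. ennreal (4 ^ k * (u (Suc k) s - u k s)\<^sup>2)"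
  have "(\<integral>\<^sup>+ s. (\<Sum>k. ?q k s) \<partial>lebesgue_on \<Omega>) = (\<Sum>k. \<integral>\<^sup>+ s. ?q k s \<partial>lebesgue_on \<Omega>)"
    by (rule nn_integral_suminf) measurable
  also have "\<dots> \<le> (\<Sum>k. ennreal ((1/2) ^ k))"
  proof (rule suminf_le)
    fix k
    have "(\<integral>\<^sup>+ s. ?q k s \<partial>lebesgue_on \<Omega>) =
      ennreal (4 ^ k) * (\<integral>\<^sup>+ s. ennreal ((u (Suc k) s - u k s)\<^sup>2) \<partial>lebesgue_on \<Omega>)"
      by (subst nn_integral_cmult[symmetric]) (auto simp: ennreal_mult)
    also have "\<dots> = ennreal (4 ^ k * (L2_norm \<Omega> (\<lambda>s. u (Suc k) s - u k s))\<^sup>2)"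
      using L2_nn_integral[OF L2_diff[OF u u]] by (simp add: ennreal_mult)
    also have "\<dots> \<le> ennreal (4 ^ k * (1/8) ^ k)"
      by (intro ennreal_leI mult_left_mono fast) simp
    also have "4 ^ k * (1/8) ^ k = ((1/2) ^ k :: real)"
      by (simp flip: power_mult_distrib)
    finally show "(\<integral>\<^sup>+ s. ?q k s \<partial>lebesgue_on \<Omega>) \<le> ennreal ((1/2) ^ k)" .
  qed auto
  also have "\<dots> = ennreal (\<Sum>k. (1/2) ^ k)"
    by (rule suminf_ennreal2) (auto intro: summable_geometric)
  finally have fin: "(\<integral>\<^sup>+ s. (\<Sum>k. ?q k s) \<partial>lebesgue_on \<Omega>) \<noteq> \<infinity>"
    by (auto simp: top_unique)
  have "AE s in lebesgue_on \<Omega>. (\<Sum>k. ?q k s) \<noteq> \<infinity>"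
    by (rule nn_integral_PInf_AE[OF _ fin]) measurable
  then show ?thesis
  proof eventually_elim
    case (elim s)
    then have "(\<Sum>k. ?q k s) \<noteq> top"
      unfolding infinity_ennreal_def .
    then obtain c where c: "(\<Sum>k. ?q k s) = ennreal c" "c \<ge> 0"
      using ennreal_cases[of "\<Sum>k. ?q k s"] by blast
    have le: "\<bar>u (Suc k) s - u k s\<bar> \<le> sqrt c * (1/2) ^ k" for k
    proof -
      have "sum q {k} \<le> (\<Sum>k. q k)" for q :: "nat \<Rightarrow> ennreal"
        by (rule sum_le_suminf) (simp_all add: summableI)
      from this[of "\<lambda>k. ?q k s"] have "ennreal (4 ^ k * (u (Suc k) s - u k s)\<^sup>2) \<le> ennreal c"
        unfolding c(1) by simp
      then have "4 ^ k * (u (Suc k) s - u k s)\<^sup>2 \<le> c"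
        using c(2) by simp
      moreover have "(4::real) ^ k = (2 ^ k)\<^sup>2"
        by (simp add: power2_eq_square flip: power_mult_distrib)
      ultimately have "(2 ^ k * \<bar>u (Suc k) s - u k s\<bar>)\<^sup>2 \<le> c"
        by (simp only: power_mult_distrib power2_abs)
      then have "2 ^ k * \<bar>u (Suc k) s - u k s\<bar> \<le> sqrt c"
        by (rule real_le_rsqrt)
      then have "\<bar>u (Suc k) s - u k s\<bar> \<le> sqrt c / 2 ^ k"
        by (subst pos_le_divide_eq) (simp_all add: mult.commute)
      then show ?thesis by (simp add: power_divide)
    qed
    have "summable (\<lambda>k. sqrt c * (1/2) ^ k :: real)"
      by (intro summable_mult summable_geometric) simp
    then have "summable (\<lambda>k. u (Suc k) s - u k s)"
      by (rule summable_comparison_test'[where N = 0]) (use le in simp)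
    then have "convergent (\<lambda>n. \<Sum>k<n. u (Suc k) s - u k s)"
      by (simp add: summable_iff_convergent)
    then have "convergent (\<lambda>n. u n s - u 0 s)"
      by (simp only: sum_lessThan_telescope[of "\<lambda>k. u k s"])
    then have "convergent (\<lambda>n. (u n s - u 0 s) + u 0 s)"
      by (rule convergent_add[OF _ convergent_const])
    then show ?case by simp
  qed
qed

text \<open>Cauchy sequences are described by the product filter, so that estimates in two independent
  indices can be passed to the limit in the same way as estimates in one index.\<close>

theorem L2_complete:
  assumes u: "\<And>k. u k \<in> L2 \<Omega>"
    and Cauchy: "((\<lambda>(k, l). L2_norm \<Omega> (\<lambda>s. u k s - u l s)) \<longlongrightarrow> 0) (sequentially \<times>\<^sub>F sequentially)"
  shows "\<exists>v\<in>L2 \<Omega>. L2_tendsto \<Omega> u v"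
proof -
  have C: "\<exists>N. \<forall>k\<ge>N. \<forall>l\<ge>N. L2_norm \<Omega> (\<lambda>s. u k s - u l s) < e" if "e > 0" for e
    using order_tendstoD(2)[OF Cauchy that] by (simp add: eventually_prod_sequentially) blast
  have "\<exists>r. strict_mono r \<and> (\<forall>n. \<forall>k\<ge>r n. \<forall>l\<ge>r n. L2_norm \<Omega> (\<lambda>s. u k s - u l s) < (1/4) ^ n)"
  proof -
    have "\<exists>r. \<forall>n. (\<forall>k\<ge>r n. \<forall>l\<ge>r n. L2_norm \<Omega> (\<lambda>s. u k s - u l s) < (1/4) ^ n) \<and> r n < (r (Suc n) :: nat)"
    proof (rule dependent_nat_choice)
      show "\<exists>x. \<forall>k\<ge>x. \<forall>l\<ge>x. L2_norm \<Omega> (\<lambda>s. u k s - u l s) < (1/4) ^ 0"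
        using C[of 1] by simp
      fix x n
      obtain N where "\<forall>k\<ge>N. \<forall>l\<ge>N. L2_norm \<Omega> (\<lambda>s. u k s - u l s) < (1/4) ^ Suc n"
        using C[of "(1/4) ^ Suc n"] by auto
      then show "\<exists>y. (\<forall>k\<ge>y. \<forall>l\<ge>y. L2_norm \<Omega> (\<lambda>s. u k s - u l s) < (1/4) ^ Suc n) \<and> x < y"
        by (intro exI[of _ "max N (Suc x)"]) auto
    qed
    then show ?thesis by (auto simp: strict_mono_Suc_iff)
  qed
  then obtain r where r: "strict_mono r"
    and rC: "\<And>n k l. k \<ge> r n \<Longrightarrow> l \<ge> r n \<Longrightarrow> L2_norm \<Omega> (\<lambda>s. u k s - u l s) < (1/4) ^ n" by blast
  have "AE s in lebesgue_on \<Omega>. convergent (\<lambda>k. u (r k) s)"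
  proof (rule L2_fast_Cauchy_AE[OF u])
    fix k
    have "L2_norm \<Omega> (\<lambda>s. u (r (Suc k)) s - u (r k) s) < (1/4) ^ k"
      using r by (intro rC) (auto simp: strict_mono_less_eq)
    then have "(L2_norm \<Omega> (\<lambda>s. u (r (Suc k)) s - u (r k) s))\<^sup>2 \<le> ((1/4) ^ k)\<^sup>2"
      by (intro power_mono) (auto simp: L2_norm_nonneg)
    also have "\<dots> = (1/16) ^ k" by (simp add: power2_eq_square flip: power_mult_distrib)
    also have "\<dots> \<le> (1/8) ^ k" by (intro power_mono) auto
    finally show "(L2_norm \<Omega> (\<lambda>s. u (r (Suc k)) s - u (r k) s))\<^sup>2 \<le> (1/8) ^ k" .
  qed
  define v where "v s = lim (\<lambda>k. u (r k) s)" for s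
  have lim: "AE s in lebesgue_on \<Omega>. (\<lambda>k. u (r k) s) \<longlonglongrightarrow> v s"
    using \<open>AE s in lebesgue_on \<Omega>. convergent (\<lambda>k. u (r k) s)\<close>
    by eventually_elim (simp add: v_def convergent_LIMSEQ_iff)
  note [measurable] = L2_D(1)[OF u]
  have v_meas [measurable]: "v \<in> borel_measurable (lebesgue_on \<Omega>)"
    unfolding v_def by measurable
  have close: "L2_norm \<Omega> (\<lambda>s. u k s - v s) \<le> (1/4) ^ n" "(\<lambda>s. u k s - v s) \<in> L2 \<Omega>"
    if "k \<ge> r n" for k n
  proof -
    have "\<forall>\<^sub>F j in sequentially. L2_norm \<Omega> (\<lambda>s. u k s - u (r j) s) \<le> (1/4) ^ n"
      using eventually_ge_at_top[of n]
    proof eventually_elim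
      case (elim j)
      then show ?case
        using rC[of n k "r j"] that r by (simp add: strict_mono_less_eq less_imp_le)
    qed
    moreover have "AE s in lebesgue_on \<Omega>. (\<lambda>j. u k s - u (r j) s) \<longlonglongrightarrow> u k s - v s"
      using lim by eventually_elim (intro tendsto_intros)
    ultimately show "L2_norm \<Omega> (\<lambda>s. u k s - v s) \<le> (1/4) ^ n" "(\<lambda>s. u k s - v s) \<in> L2 \<Omega>"
      using L2_Fatou[of "\<lambda>j s. u k s - u (r j) s" \<Omega> "\<lambda>s. u k s - v s" "(1/4) ^ n"]
      by (auto intro: L2_diff u)
  qed
  have "v \<in> L2 \<Omega>"
    using L2_diff[OF u close(2)[of 0 "r 0"], of "r 0"] by simp
  moreover have "L2_tendsto \<Omega> u v"
    unfolding L2_tendsto_def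
  proof (rule LIMSEQ_I)
    fix e :: real assume "e > 0"
    then obtain n where "(1/4) ^ n < e" using real_arch_pow_inv[of e "1/4"] by auto
    then show "\<exists>N. \<forall>k\<ge>N. norm (L2_norm \<Omega> (\<lambda>s. u k s - v s) - 0) < e"
      using close(1)[of n] by (intro exI[of _ "r n"]) (force simp: L2_norm_nonneg)
  qed
  ultimately show ?thesis by blast
qed

lemma L2_tendsto_imp_weakly:
  assumes "\<And>k. u k \<in> L2 \<Omega>" "v \<in> L2 \<Omega>" "L2_tendsto \<Omega> u v"
  shows "L2_weakly_tendsto \<Omega> u v"
  unfolding L2_weakly_tendsto_def
proof (intro allI impI)
  fix F assume F: "L2_bounded_functional \<Omega> F"
  then obtain C where C: "\<And>u. u \<in> L2 \<Omega> \<Longrightarrow> \<bar>F u\<bar> \<le> C * L2_norm \<Omega> u"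
    unfolding L2_bounded_functional_def by blast
  have add: "F (\<lambda>s. a s + b s) = F a + F b" if "a \<in> L2 \<Omega>" "b \<in> L2 \<Omega>" for a b
    using F that unfolding L2_bounded_functional_def by simp
  have cmult: "F (\<lambda>s. c * a s) = c * F a" if "a \<in> L2 \<Omega>" for a c
    using F that unfolding L2_bounded_functional_def by simp
  have "F (\<lambda>s. u k s - v s) = F (u k) - F v" for k
    using add[OF assms(1)[of k] L2_cmult[OF assms(2), of "- 1"]] cmult[OF assms(2), of "- 1"] by simp
  then have "norm (F (u k) - F v) \<le> C * L2_norm \<Omega> (\<lambda>s. u k s - v s)" for k
    using C[OF L2_diff[OF assms(1)[of k] assms(2)]] by simp
  moreover have "(\<lambda>k. C * L2_norm \<Omega> (\<lambda>s. u k s - v s)) \<longlonglongrightarrow> 0"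
    using assms(3) unfolding L2_tendsto_def by (rule tendsto_mult_right_zero)
  ultimately have "(\<lambda>k. F (u k) - F v) \<longlonglongrightarrow> 0"
    by (intro Lim_null_comparison[of "\<lambda>k. F (u k) - F v"]) auto
  then show "(\<lambda>k. F (u k)) \<longlonglongrightarrow> F v" by (simp add: LIM_zero_iff)
qed

lemma L2_norm_tendsto:
  assumes "\<And>i. u i \<in> L2 \<Omega>" "v \<in> L2 \<Omega>" "((\<lambda>i. L2_norm \<Omega> (\<lambda>s. u i s - v s)) \<longlongrightarrow> 0) F"
  shows "((\<lambda>i. L2_norm \<Omega> (u i)) \<longlongrightarrow> L2_norm \<Omega> v) F"
proof -
  have "((\<lambda>i. L2_norm \<Omega> (u i) - L2_norm \<Omega> v) \<longlongrightarrow> 0) F"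
    using L2_norm_diff_ineq[OF assms(1,2)]
    by (intro Lim_null_comparison[OF _ assms(3)]) auto
  then show ?thesis by (simp add: LIM_zero_iff)
qed

section \<open>Bounded bilinear operators\<close>

lemma L2_bilinear_closed:
  assumes "L2_bounded_bilinear \<Omega> T" "g \<in> L2 \<Omega>" "x \<in> L2 \<Omega>"
  shows "T g x \<in> L2 \<Omega>"
  using assms unfolding L2_bounded_bilinear_def by blast

lemma L2_bilinear_lincomb_left:
  assumes T: "L2_bounded_bilinear \<Omega> T" and L2: "g \<in> L2 \<Omega>" "h \<in> L2 \<Omega>" "x \<in> L2 \<Omega>"
  shows "eq_AE \<Omega> (T (\<lambda>s. a * g s + b * h s) x) (\<lambda>s. a * T g x s + b * T h x s)"
proof -
  have "eq_AE \<Omega> (T (\<lambda>s. a * g s + b * h s) x) (\<lambda>s. T (\<lambda>s. a * g s) x s + T (\<lambda>s. b * h s) x s)"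
    using T L2_cmult[OF L2(1), of a] L2_cmult[OF L2(2), of b] L2(3)
    unfolding L2_bounded_bilinear_def by simp
  moreover have "eq_AE \<Omega> (T (\<lambda>s. a * g s) x) (\<lambda>s. a * T g x s)"
    using T L2 unfolding L2_bounded_bilinear_def by simp
  moreover have "eq_AE \<Omega> (T (\<lambda>s. b * h s) x) (\<lambda>s. b * T h x s)"
    using T L2 unfolding L2_bounded_bilinear_def by simp
  ultimately show ?thesis
    unfolding eq_AE_def by eventually_elim simp
qed

lemma L2_bilinear_lincomb_right:
  assumes T: "L2_bounded_bilinear \<Omega> T" and L2: "g \<in> L2 \<Omega>" "x \<in> L2 \<Omega>" "z \<in> L2 \<Omega>"
  shows "eq_AE \<Omega> (T g (\<lambda>s. a * x s + b * z s)) (\<lambda>s. a * T g x s + b * T g z s)"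
proof -
  have "eq_AE \<Omega> (T g (\<lambda>s. a * x s + b * z s)) (\<lambda>s. T g (\<lambda>s. a * x s) s + T g (\<lambda>s. b * z s) s)"
    using T L2_cmult[OF L2(2), of a] L2_cmult[OF L2(3), of b] L2(1)
    unfolding L2_bounded_bilinear_def by simp
  moreover have "eq_AE \<Omega> (T g (\<lambda>s. a * x s)) (\<lambda>s. a * T g x s)"
    using T L2 unfolding L2_bounded_bilinear_def by simp
  moreover have "eq_AE \<Omega> (T g (\<lambda>s. b * z s)) (\<lambda>s. b * T g z s)"
    using T L2 unfolding L2_bounded_bilinear_def by simp
  ultimately show ?thesis
    unfolding eq_AE_def by eventually_elim simp
qed

lemma L2_bilinear_bound:
  assumes "L2_bounded_bilinear \<Omega> T"
  obtains C where "C \<ge> 0"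
    "\<And>g x. g \<in> L2 \<Omega> \<Longrightarrow> x \<in> L2 \<Omega> \<Longrightarrow> L2_norm \<Omega> (T g x) \<le> C * L2_norm \<Omega> g * L2_norm \<Omega> x"
proof -
  obtain C where C: "\<And>g x. g \<in> L2 \<Omega> \<Longrightarrow> x \<in> L2 \<Omega> \<Longrightarrow>
      L2_norm \<Omega> (T g x) \<le> C * L2_norm \<Omega> g * L2_norm \<Omega> x"
    using assms unfolding L2_bounded_bilinear_def by blast
  show thesis
  proof (rule that[of "\<bar>C\<bar>"])
    fix g x assume "g \<in> L2 \<Omega>" "x \<in> L2 \<Omega>"
    then have "L2_norm \<Omega> (T g x) \<le> C * (L2_norm \<Omega> g * L2_norm \<Omega> x)"
      using C by (simp add: mult.assoc)
    also have "\<dots> \<le> \<bar>C\<bar> * (L2_norm \<Omega> g * L2_norm \<Omega> x)"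
      by (intro mult_right_mono) (auto simp: L2_norm_nonneg)
    finally show "L2_norm \<Omega> (T g x) \<le> \<bar>C\<bar> * L2_norm \<Omega> g * L2_norm \<Omega> x"
      by (simp add: mult.assoc)
  qed simp
qed

lemma L2_bilinear_norm_diff_left:
  assumes T: "L2_bounded_bilinear \<Omega> T" and L2: "g \<in> L2 \<Omega>" "h \<in> L2 \<Omega>" "x \<in> L2 \<Omega>"
  shows "L2_norm \<Omega> (\<lambda>s. T g x s - T h x s) = L2_norm \<Omega> (T (\<lambda>s. g s - h s) x)"
  using L2_bilinear_lincomb_left[OF T L2, of 1 "-1"]
  by (intro L2_norm_cong_AE[OF eq_AE_sym] L2_diff L2_bilinear_closed[OF T] L2) simp_all

lemma L2_bilinear_norm_diff_right:
  assumes T: "L2_bounded_bilinear \<Omega> T" and L2: "g \<in> L2 \<Omega>" "x \<in> L2 \<Omega>" "z \<in> L2 \<Omega>"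
  shows "L2_norm \<Omega> (\<lambda>s. T g x s - T g z s) = L2_norm \<Omega> (T g (\<lambda>s. x s - z s))"
  using L2_bilinear_lincomb_right[OF T L2, of 1 "-1"]
  by (intro L2_norm_cong_AE[OF eq_AE_sym] L2_diff L2_bilinear_closed[OF T] L2) simp_all

section \<open>The inner problem\<close>

text \<open>The inner problem \<open>min\<^sub>x 1/2 \<parallel>T g x - y\<parallel>\<^sup>2 + \<alpha> R(x)\<close>; \<open>y\<close> and \<open>g\<close> are arguments of the definitions
  below, as they vary.\<close>

locale inner_problem =
  fixes \<Omega> :: "'a::euclidean_space set"
    and T :: "('a \<Rightarrow> real) \<Rightarrow> ('a \<Rightarrow> real) \<Rightarrow> ('a \<Rightarrow> real)"
    and R :: "('a \<Rightarrow> real) \<Rightarrow> ennreal" and \<alpha> :: real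
  assumes T: "L2_bounded_bilinear \<Omega> T" and \<alpha>: "\<alpha> > 0"
    and R_convex: "L2_strongly_convex \<Omega> R" and R_lsc: "L2_weakly_lsc \<Omega> R"
    and R_proper: "\<exists>x\<in>L2 \<Omega>. R x \<noteq> \<infinity>"
begin

text \<open>The effective domain of \<open>R\<close>.\<close>

definition eff_dom :: "('a \<Rightarrow> real) set" where
  "eff_dom = {x \<in> L2 \<Omega>. R x \<noteq> \<infinity>}"

definition data_fit :: "('a \<Rightarrow> real) \<Rightarrow> ('a \<Rightarrow> real) \<Rightarrow> ('a \<Rightarrow> real) \<Rightarrow> real" where
  "data_fit y g x = 1 / 2 * (L2_norm \<Omega> (\<lambda>s. T g x s - y s))\<^sup>2"

text \<open>The inner objective as a real number; meaningful on the effective domain only.\<close>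

definition real_objective :: "('a \<Rightarrow> real) \<Rightarrow> ('a \<Rightarrow> real) \<Rightarrow> ('a \<Rightarrow> real) \<Rightarrow> real" where
  "real_objective y g x = data_fit y g x + \<alpha> * enn2real (R x)"

lemma eff_dom_L2: "x \<in> eff_dom \<Longrightarrow> x \<in> L2 \<Omega>"
  by (simp add: eff_dom_def)

lemma ennreal_R: "x \<in> eff_dom \<Longrightarrow> ennreal (enn2real (R x)) = R x"
  by (simp add: eff_dom_def less_top)

lemma data_fit_nonneg: "0 \<le> data_fit y g x"
  by (simp add: data_fit_def)

lemma real_objective_nonneg: "0 \<le> real_objective y g x"
  using \<alpha> by (simp add: real_objective_def data_fit_nonneg)

lemma inner_objective_eff_dom:
  assumes "x \<in> eff_dom"
  shows "inner_objective \<Omega> T R \<alpha> y g x = ennreal (real_objective y g x)"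
proof -
  have "inner_objective \<Omega> T R \<alpha> y g x =
      ennreal (data_fit y g x) + ennreal \<alpha> * ennreal (enn2real (R x))"
    by (simp only: inner_objective_def data_fit_def ennreal_R[OF assms])
  also have "\<dots> = ennreal (real_objective y g x)"
    using \<alpha> data_fit_nonneg[of y g x]
    by (simp only: real_objective_def ennreal_plus ennreal_mult enn2real_nonneg
          mult_nonneg_nonneg less_imp_le)
  finally show ?thesis .
qed

lemma inner_objective_infinite:
  assumes "x \<in> L2 \<Omega>" "x \<notin> eff_dom"
  shows "inner_objective \<Omega> T R \<alpha> y g x = \<infinity>"
  using assms \<alpha> by (simp add: inner_objective_def eff_dom_def ennreal_mult_top)

text \<open>Strong convexity at the midpoint, stated for real numbers.\<close>

lemma convexity_modulus:
  obtains m where "m > 0"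
    "\<And>u v. u \<in> eff_dom \<Longrightarrow> v \<in> eff_dom \<Longrightarrow> (\<lambda>s. 1/2 * u s + 1/2 * v s) \<in> eff_dom"
    "\<And>u v. u \<in> eff_dom \<Longrightarrow> v \<in> eff_dom \<Longrightarrow>
      enn2real (R (\<lambda>s. 1/2 * u s + 1/2 * v s)) + m / 8 * (L2_norm \<Omega> (\<lambda>s. u s - v s))\<^sup>2
        \<le> 1/2 * enn2real (R u) + 1/2 * enn2real (R v)"
proof -
  obtain m where m: "m > 0" and conv: "\<And>u v t. u \<in> L2 \<Omega> \<Longrightarrow> v \<in> L2 \<Omega> \<Longrightarrow> t \<in> {0<..<1} \<Longrightarrow>
        R (\<lambda>s. t * u s + (1 - t) * v s)
          + ennreal (m / 2 * t * (1 - t) * (L2_norm \<Omega> (\<lambda>s. u s - v s))\<^sup>2)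
        \<le> ennreal t * R u + ennreal (1 - t) * R v"
    using R_convex unfolding L2_strongly_convex_def by blast
  have le: "R (\<lambda>s. 1/2 * u s + 1/2 * v s) + ennreal (m / 8 * (L2_norm \<Omega> (\<lambda>s. u s - v s))\<^sup>2)
      \<le> ennreal (1/2 * enn2real (R u) + 1/2 * enn2real (R v))"
    if "u \<in> eff_dom" "v \<in> eff_dom" for u v
  proof -
    have "R (\<lambda>s. 1/2 * u s + 1/2 * v s) + ennreal (m / 8 * (L2_norm \<Omega> (\<lambda>s. u s - v s))\<^sup>2)
      \<le> ennreal (1/2) * R u + ennreal (1/2) * R v"
      using conv[OF that[THEN eff_dom_L2], of "1/2"] by simp
    also have "\<dots> = ennreal (1/2) * ennreal (enn2real (R u)) + ennreal (1/2) * ennreal (enn2real (R v))"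
      by (simp only: ennreal_R that)
    also have "\<dots> = ennreal (1/2 * enn2real (R u) + 1/2 * enn2real (R v))"
      by (simp only: ennreal_plus ennreal_mult enn2real_nonneg mult_nonneg_nonneg)
    finally show ?thesis .
  qed
  have mid: "(\<lambda>s. 1/2 * u s + 1/2 * v s) \<in> eff_dom" if "u \<in> eff_dom" "v \<in> eff_dom" for u v
  proof -
    have "R (\<lambda>s. 1/2 * u s + 1/2 * v s) \<le>
        R (\<lambda>s. 1/2 * u s + 1/2 * v s) + ennreal (m / 8 * (L2_norm \<Omega> (\<lambda>s. u s - v s))\<^sup>2)"
      by simp
    also note le[OF that]
    finally have "R (\<lambda>s. 1/2 * u s + 1/2 * v s) < top"
      by (rule le_less_trans) simp
    then show ?thesis
      using L2_lincomb[OF that[THEN eff_dom_L2], of "1/2" "1/2"] by (simp add: eff_dom_def)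
  qed
  show thesis
  proof (rule that[OF m mid])
    fix u v assume uv: "u \<in> eff_dom" "v \<in> eff_dom"
    have "ennreal (enn2real (R (\<lambda>s. 1/2 * u s + 1/2 * v s)) + m / 8 * (L2_norm \<Omega> (\<lambda>s. u s - v s))\<^sup>2) =
      R (\<lambda>s. 1/2 * u s + 1/2 * v s) + ennreal (m / 8 * (L2_norm \<Omega> (\<lambda>s. u s - v s))\<^sup>2)"
      using m by (subst ennreal_plus) (simp_all only: ennreal_R[OF mid[OF uv]] enn2real_nonneg, simp)
    also note le[OF uv]
    finally show "enn2real (R (\<lambda>s. 1/2 * u s + 1/2 * v s)) + m / 8 * (L2_norm \<Omega> (\<lambda>s. u s - v s))\<^sup>2
        \<le> 1/2 * enn2real (R u) + 1/2 * enn2real (R v)"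
      by (subst (asm) ennreal_le_iff) simp_all
  qed
qed

lemma data_fit_midpoint:
  assumes "y \<in> L2 \<Omega>" "g \<in> L2 \<Omega>" "u \<in> L2 \<Omega>" "v \<in> L2 \<Omega>"
  shows "data_fit y g (\<lambda>s. 1/2 * u s + 1/2 * v s) \<le> 1/2 * data_fit y g u + 1/2 * data_fit y g v"
proof -
  let ?a = "\<lambda>s. T g u s - y s" and ?b = "\<lambda>s. T g v s - y s"
  let ?m = "\<lambda>s. 1/2 * u s + 1/2 * v s"
  have ab: "?a \<in> L2 \<Omega>" "?b \<in> L2 \<Omega>"
    by (intro L2_diff L2_bilinear_closed[OF T] assms)+
  have "L2_norm \<Omega> (\<lambda>s. T g ?m s - y s) = L2_norm \<Omega> (\<lambda>s. 1/2 * ?a s + 1/2 * ?b s)"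
  proof (rule L2_norm_cong_AE)
    show "eq_AE \<Omega> (\<lambda>s. T g ?m s - y s) (\<lambda>s. 1/2 * ?a s + 1/2 * ?b s)"
      using L2_bilinear_lincomb_right[OF T assms(2-4), of "1/2" "1/2"] unfolding eq_AE_def
      by eventually_elim (simp add: field_simps)
  qed (intro L2_diff L2_lincomb L2_bilinear_closed[OF T] assms)+
  then show ?thesis
    using L2_parallelogram[OF ab] by (simp add: data_fit_def)
qed

lemma real_objective_midpoint:
  obtains c where "c > 0"
    "\<And>u v. u \<in> eff_dom \<Longrightarrow> v \<in> eff_dom \<Longrightarrow> (\<lambda>s. 1/2 * u s + 1/2 * v s) \<in> eff_dom"
    "\<And>y g u v. y \<in> L2 \<Omega> \<Longrightarrow> g \<in> L2 \<Omega> \<Longrightarrow> u \<in> eff_dom \<Longrightarrow> v \<in> eff_dom \<Longrightarrow>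
      real_objective y g (\<lambda>s. 1/2 * u s + 1/2 * v s) + c * (L2_norm \<Omega> (\<lambda>s. u s - v s))\<^sup>2
        \<le> 1/2 * real_objective y g u + 1/2 * real_objective y g v"
proof -
  obtain m where m: "m > 0"
    and mid: "\<And>u v. u \<in> eff_dom \<Longrightarrow> v \<in> eff_dom \<Longrightarrow> (\<lambda>s. 1/2 * u s + 1/2 * v s) \<in> eff_dom"
    and conv: "\<And>u v. u \<in> eff_dom \<Longrightarrow> v \<in> eff_dom \<Longrightarrow>
      enn2real (R (\<lambda>s. 1/2 * u s + 1/2 * v s)) + m / 8 * (L2_norm \<Omega> (\<lambda>s. u s - v s))\<^sup>2
        \<le> 1/2 * enn2real (R u) + 1/2 * enn2real (R v)"
    using convexity_modulus by blast
  show thesis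
  proof (rule that[of "\<alpha> * m / 8", OF _ mid])
    fix y g u v assume *: "y \<in> L2 \<Omega>" "g \<in> L2 \<Omega>" "u \<in> eff_dom" "v \<in> eff_dom"
    have "\<alpha> * (enn2real (R (\<lambda>s. 1/2 * u s + 1/2 * v s)) + m / 8 * (L2_norm \<Omega> (\<lambda>s. u s - v s))\<^sup>2)
        \<le> \<alpha> * (1/2 * enn2real (R u) + 1/2 * enn2real (R v))"
      using conv[OF *(3,4)] \<alpha> by (intro mult_left_mono) simp_all
    then show "real_objective y g (\<lambda>s. 1/2 * u s + 1/2 * v s)
        + \<alpha> * m / 8 * (L2_norm \<Omega> (\<lambda>s. u s - v s))\<^sup>2
        \<le> 1/2 * real_objective y g u + 1/2 * real_objective y g v"
      using data_fit_midpoint[OF *(1,2) *(3,4)[THEN eff_dom_L2]]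
      unfolding real_objective_def by (simp add: algebra_simps)
  qed (use \<alpha> m in simp_all)
qed

lemma data_fit_tendsto:
  assumes "y \<in> L2 \<Omega>" "g \<in> L2 \<Omega>" "\<And>i. u i \<in> L2 \<Omega>" "v \<in> L2 \<Omega>"
    and lim: "((\<lambda>i. L2_norm \<Omega> (\<lambda>s. u i s - v s)) \<longlongrightarrow> 0) F"
  shows "((\<lambda>i. data_fit y g (u i)) \<longlongrightarrow> data_fit y g v) F"
proof -
  obtain C where "C \<ge> 0"
    and C: "\<And>g x. g \<in> L2 \<Omega> \<Longrightarrow> x \<in> L2 \<Omega> \<Longrightarrow> L2_norm \<Omega> (T g x) \<le> C * L2_norm \<Omega> g * L2_norm \<Omega> x"
    using L2_bilinear_bound[OF T] by blast
  have "((\<lambda>i. L2_norm \<Omega> (\<lambda>s. (T g (u i) s - y s) - (T g v s - y s))) \<longlongrightarrow> 0) F"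
  proof (rule Lim_null_comparison)
    show "\<forall>\<^sub>F i in F. norm (L2_norm \<Omega> (\<lambda>s. (T g (u i) s - y s) - (T g v s - y s)))
        \<le> C * L2_norm \<Omega> g * L2_norm \<Omega> (\<lambda>s. u i s - v s)"
      using C[OF assms(2) L2_diff[OF assms(3,4)]] L2_bilinear_norm_diff_right[OF T assms(2-4)]
      by (intro always_eventually allI) (simp add: L2_norm_nonneg)
    show "((\<lambda>i. C * L2_norm \<Omega> g * L2_norm \<Omega> (\<lambda>s. u i s - v s)) \<longlongrightarrow> 0) F"
      by (intro tendsto_mult_right_zero lim)
  qed
  then have "((\<lambda>i. L2_norm \<Omega> (\<lambda>s. T g (u i) s - y s)) \<longlongrightarrow> L2_norm \<Omega> (\<lambda>s. T g v s - y s)) F"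
    by (intro L2_norm_tendsto L2_diff L2_bilinear_closed[OF T] assms)
  then show ?thesis
    unfolding data_fit_def by (intro tendsto_intros)
qed

text \<open>By strong convexity a minimizing sequence is Cauchy in norm, so that no weak compactness is
  needed for existence.\<close>

lemma real_objective_minimizer_exists:
  assumes yg: "y \<in> L2 \<Omega>" "g \<in> L2 \<Omega>"
  shows "\<exists>x\<in>eff_dom. \<forall>z\<in>eff_dom. real_objective y g x \<le> real_objective y g z"
proof -
  let ?J = "real_objective y g"
  define I where "I = (INF z\<in>eff_dom. ?J z)"
  have ne: "eff_dom \<noteq> {}" using R_proper by (auto simp: eff_dom_def)
  have bdd: "bdd_below (?J ` eff_dom)"
    by (rule bdd_belowI[of _ 0]) (auto simp: real_objective_nonneg)
  have I_le: "I \<le> ?J z" if "z \<in> eff_dom" for z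
    unfolding I_def using bdd that by (rule cINF_lower)
  have "\<exists>z\<in>eff_dom. ?J z < I + inverse (real (Suc n))" for n
    using cINF_less_iff[OF ne bdd, of "I + inverse (real (Suc n))"] by (simp add: I_def)
  then obtain u where u: "\<And>n. u n \<in> eff_dom" and uI: "\<And>n. ?J (u n) < I + inverse (real (Suc n))"
    by metis
  note uL2 = u[THEN eff_dom_L2]
  obtain c where c: "c > 0"
    and mid: "\<And>u v. u \<in> eff_dom \<Longrightarrow> v \<in> eff_dom \<Longrightarrow> (\<lambda>s. 1/2 * u s + 1/2 * v s) \<in> eff_dom"
    and conv: "\<And>y g u v. y \<in> L2 \<Omega> \<Longrightarrow> g \<in> L2 \<Omega> \<Longrightarrow> u \<in> eff_dom \<Longrightarrow> v \<in> eff_dom \<Longrightarrow>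
      real_objective y g (\<lambda>s. 1/2 * u s + 1/2 * v s) + c * (L2_norm \<Omega> (\<lambda>s. u s - v s))\<^sup>2
        \<le> 1/2 * real_objective y g u + 1/2 * real_objective y g v"
    using real_objective_midpoint by blast
  \<comment> \<open>The midpoint has an objective of at least \<open>I\<close>, which bounds the distance of two terms.\<close>
  let ?e = "\<lambda>p. (inverse (real (Suc (fst p))) + inverse (real (Suc (snd p)))) / (2 * c)"
  have dist: "L2_norm \<Omega> (\<lambda>s. u k s - u l s) \<le> sqrt (?e (k, l))" for k l
  proof (rule real_le_rsqrt)
    have "c * (L2_norm \<Omega> (\<lambda>s. u k s - u l s))\<^sup>2 \<le> (inverse (real (Suc k)) + inverse (real (Suc l))) / 2"
      using conv[OF yg u[of k] u[of l]] I_le[OF mid[OF u[of k] u[of l]]] uI[of k] uI[of l]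
      by (simp only: add_divide_distrib)
    then have "(L2_norm \<Omega> (\<lambda>s. u k s - u l s))\<^sup>2 \<le>
        ((inverse (real (Suc k)) + inverse (real (Suc l))) / 2) / c"
      using c by (subst pos_le_divide_eq) (simp_all only: mult.commute)
    then show "(L2_norm \<Omega> (\<lambda>s. u k s - u l s))\<^sup>2 \<le> ?e (k, l)"
      by (simp only: fst_conv snd_conv divide_divide_eq_left)
  qed
  have e: "((\<lambda>p. sqrt (?e p)) \<longlongrightarrow> 0) (sequentially \<times>\<^sub>F sequentially)"
  proof -
    have "((\<lambda>p. sqrt (?e p)) \<longlongrightarrow> sqrt ((0 + 0) / (2 * c))) (sequentially \<times>\<^sub>F sequentially)"
      using c by (intro tendsto_intros filterlim_compose[OF LIMSEQ_inverse_real_of_nat]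
          filterlim_fst filterlim_snd) simp_all
    then show ?thesis by simp
  qed
  have "((\<lambda>(k, l). L2_norm \<Omega> (\<lambda>s. u k s - u l s)) \<longlongrightarrow> 0) (sequentially \<times>\<^sub>F sequentially)"
    using dist by (intro Lim_null_comparison[OF _ e] always_eventually) (auto simp: L2_norm_nonneg)
  then obtain v where v: "v \<in> L2 \<Omega>" and lim: "L2_tendsto \<Omega> u v"
    using L2_complete[of u \<Omega>, OF uL2] by blast
  have J: "(\<lambda>n. ?J (u n)) \<longlonglongrightarrow> I"
  proof (rule tendsto_sandwich[OF always_eventually always_eventually tendsto_const])
    show "\<forall>n. I \<le> ?J (u n)" using I_le[OF u] by blast
    show "\<forall>n. ?J (u n) \<le> I + inverse (real (Suc n))" using uI less_imp_le by blast
    show "(\<lambda>n. I + inverse (real (Suc n))) \<longlonglongrightarrow> I"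
      using tendsto_add[OF tendsto_const[of I] LIMSEQ_inverse_real_of_nat] by simp
  qed
  have fit: "(\<lambda>n. data_fit y g (u n)) \<longlonglongrightarrow> data_fit y g v"
    using lim unfolding L2_tendsto_def by (intro data_fit_tendsto yg uL2 v)
  have "(\<lambda>n. (?J (u n) - data_fit y g (u n)) / \<alpha>) \<longlonglongrightarrow> (I - data_fit y g v) / \<alpha>"
    using \<alpha> by (intro tendsto_intros J fit) simp
  then have r: "(\<lambda>n. enn2real (R (u n))) \<longlonglongrightarrow> (I - data_fit y g v) / \<alpha>"
    using \<alpha> by (simp add: real_objective_def)
  then have nonneg: "0 \<le> (I - data_fit y g v) / \<alpha>"
    by (rule LIMSEQ_le_const) simp
  have "(\<lambda>n. ennreal (enn2real (R (u n)))) \<longlonglongrightarrow> ennreal ((I - data_fit y g v) / \<alpha>)"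
    using r by (rule tendsto_ennrealI)
  then have "(\<lambda>n. R (u n)) \<longlonglongrightarrow> ennreal ((I - data_fit y g v) / \<alpha>)"
    by (simp only: ennreal_R[OF u])
  then have "liminf (\<lambda>n. R (u n)) = ennreal ((I - data_fit y g v) / \<alpha>)"
    by (rule lim_imp_Liminf[OF sequentially_bot])
  moreover have "R v \<le> liminf (\<lambda>n. R (u n))"
    using R_lsc L2_tendsto_imp_weakly[OF uL2 v lim] uL2 v unfolding L2_weakly_lsc_def by blast
  ultimately have Rv: "R v \<le> ennreal ((I - data_fit y g v) / \<alpha>)" by simp
  then have "R v < top" by (rule le_less_trans) simp
  then have vdom: "v \<in> eff_dom" using v by (simp add: eff_dom_def)
  have "ennreal (enn2real (R v)) \<le> ennreal ((I - data_fit y g v) / \<alpha>)"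
    using Rv by (simp only: ennreal_R[OF vdom])
  then have "enn2real (R v) \<le> (I - data_fit y g v) / \<alpha>"
    using nonneg by (simp only: ennreal_le_iff)
  then have "?J v \<le> I"
    using \<alpha> by (simp add: real_objective_def pos_le_divide_eq mult.commute)
  then show ?thesis
    using vdom I_le by (blast intro: order_trans)
qed

lemma inner_minimizer:
  assumes yg: "y \<in> L2 \<Omega>" "g \<in> L2 \<Omega>"
  shows inner_minimizer_eff_dom: "inner_minimizer \<Omega> T R \<alpha> y g \<in> eff_dom"
    and inner_minimizer_le:
      "z \<in> eff_dom \<Longrightarrow> real_objective y g (inner_minimizer \<Omega> T R \<alpha> y g) \<le> real_objective y g z"
proof -
  let ?O = "inner_objective \<Omega> T R \<alpha> y g" and ?x = "inner_minimizer \<Omega> T R \<alpha> y g"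
  obtain v where v: "v \<in> eff_dom" "\<And>z. z \<in> eff_dom \<Longrightarrow> real_objective y g v \<le> real_objective y g z"
    using real_objective_minimizer_exists[OF yg] by blast
  have "?O v \<le> ?O z" if "z \<in> L2 \<Omega>" for z
    using v that by (cases "z \<in> eff_dom")
      (simp_all add: inner_objective_eff_dom inner_objective_infinite ennreal_leI)
  then have "is_arg_min ?O (\<lambda>x. x \<in> L2 \<Omega>) v"
    using v(1) by (simp add: is_arg_min_linorder eff_dom_L2)
  then have "is_arg_min ?O (\<lambda>x. x \<in> L2 \<Omega>) ?x"
    unfolding inner_minimizer_def arg_min_def
    by (rule someI[where P = "is_arg_min ?O (\<lambda>x. x \<in> L2 \<Omega>)"])
  then have x: "?x \<in> L2 \<Omega>" "\<And>z. z \<in> L2 \<Omega> \<Longrightarrow> ?O ?x \<le> ?O z"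
    by (simp_all add: is_arg_min_linorder)
  show dom: "?x \<in> eff_dom"
  proof (rule ccontr)
    assume "?x \<notin> eff_dom"
    then have "\<infinity> \<le> ?O v"
      using x(2)[OF eff_dom_L2[OF v(1)]] inner_objective_infinite[OF x(1)] by simp
    then show False by (simp add: inner_objective_eff_dom[OF v(1)] top_unique)
  qed
  show "real_objective y g ?x \<le> real_objective y g z" if "z \<in> eff_dom"
    using x(2)[OF eff_dom_L2[OF that]]
    by (simp add: inner_objective_eff_dom[OF that] inner_objective_eff_dom[OF dom] real_objective_nonneg)
qed

lemma inner_minimizer_L2:
  "y \<in> L2 \<Omega> \<Longrightarrow> g \<in> L2 \<Omega> \<Longrightarrow> inner_minimizer \<Omega> T R \<alpha> y g \<in> L2 \<Omega>"
  by (rule eff_dom_L2[OF inner_minimizer_eff_dom])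

text \<open>Quadratic growth of the inner objective away from its minimizer.\<close>

lemma quadratic_growth:
  obtains c where "c > 0"
    "\<And>y g z. y \<in> L2 \<Omega> \<Longrightarrow> g \<in> L2 \<Omega> \<Longrightarrow> z \<in> eff_dom \<Longrightarrow>
      c * (L2_norm \<Omega> (\<lambda>s. z s - inner_minimizer \<Omega> T R \<alpha> y g s))\<^sup>2
        \<le> real_objective y g z - real_objective y g (inner_minimizer \<Omega> T R \<alpha> y g)"
proof -
  obtain c where c: "c > 0"
    and mid: "\<And>u v. u \<in> eff_dom \<Longrightarrow> v \<in> eff_dom \<Longrightarrow> (\<lambda>s. 1/2 * u s + 1/2 * v s) \<in> eff_dom"
    and conv: "\<And>y g u v. y \<in> L2 \<Omega> \<Longrightarrow> g \<in> L2 \<Omega> \<Longrightarrow> u \<in> eff_dom \<Longrightarrow> v \<in> eff_dom \<Longrightarrow>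
      real_objective y g (\<lambda>s. 1/2 * u s + 1/2 * v s) + c * (L2_norm \<Omega> (\<lambda>s. u s - v s))\<^sup>2
        \<le> 1/2 * real_objective y g u + 1/2 * real_objective y g v"
    using real_objective_midpoint by blast
  show thesis
  proof (rule that[of "2 * c"])
    fix y g z assume yg: "y \<in> L2 \<Omega>" "g \<in> L2 \<Omega>" and z: "z \<in> eff_dom"
    note x = inner_minimizer_eff_dom[OF yg]
    show "2 * c * (L2_norm \<Omega> (\<lambda>s. z s - inner_minimizer \<Omega> T R \<alpha> y g s))\<^sup>2
        \<le> real_objective y g z - real_objective y g (inner_minimizer \<Omega> T R \<alpha> y g)"
      using conv[OF yg z x] inner_minimizer_le[OF yg mid[OF z x]] by linarith
  qed (use c in simp)
qed

text \<open>Continuous dependence of the inner minimizer on the data and the parameter, along an arbitrary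
  filter. Applying quadratic growth to both problems, each tested with the minimizer of the other,
  and adding up eliminates \<open>R\<close>.\<close>

theorem inner_minimizer_stable:
  assumes y: "\<And>i. y i \<in> L2 \<Omega>" "y0 \<in> L2 \<Omega>" "((\<lambda>i. L2_norm \<Omega> (\<lambda>s. y i s - y0 s)) \<longlongrightarrow> 0) F"
    and g: "\<And>i. g i \<in> L2 \<Omega>" "g0 \<in> L2 \<Omega>" "((\<lambda>i. L2_norm \<Omega> (\<lambda>s. g i s - g0 s)) \<longlongrightarrow> 0) F"
  shows "((\<lambda>i. L2_norm \<Omega> (\<lambda>s. inner_minimizer \<Omega> T R \<alpha> (y i) (g i) s
      - inner_minimizer \<Omega> T R \<alpha> y0 g0 s)) \<longlongrightarrow> 0) F"
proof -
  define x where "x i = inner_minimizer \<Omega> T R \<alpha> (y i) (g i)" for i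
  define x0 where "x0 = inner_minimizer \<Omega> T R \<alpha> y0 g0"
  define d where "d i = L2_norm \<Omega> (\<lambda>s. x i s - x0 s)" for i
  have x: "x i \<in> eff_dom" for i unfolding x_def by (rule inner_minimizer_eff_dom[OF y(1) g(1)])
  have x0: "x0 \<in> eff_dom" unfolding x0_def by (rule inner_minimizer_eff_dom[OF y(2) g(2)])
  note xL2 = x[THEN eff_dom_L2] and x0L2 = x0[THEN eff_dom_L2]
  have d0: "0 \<le> d i" for i by (simp add: d_def L2_norm_nonneg)
  have d_sym: "d i = L2_norm \<Omega> (\<lambda>s. x0 s - x i s)" for i
    unfolding d_def by (rule L2_norm_minus_commute)
  obtain C where C0: "C \<ge> 0"
    and C: "\<And>g x. g \<in> L2 \<Omega> \<Longrightarrow> x \<in> L2 \<Omega> \<Longrightarrow> L2_norm \<Omega> (T g x) \<le> C * L2_norm \<Omega> g * L2_norm \<Omega> x"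
    using L2_bilinear_bound[OF T] by blast
  obtain c where c: "c > 0" and growth: "\<And>y g z. y \<in> L2 \<Omega> \<Longrightarrow> g \<in> L2 \<Omega> \<Longrightarrow> z \<in> eff_dom \<Longrightarrow>
      c * (L2_norm \<Omega> (\<lambda>s. z s - inner_minimizer \<Omega> T R \<alpha> y g s))\<^sup>2
        \<le> real_objective y g z - real_objective y g (inner_minimizer \<Omega> T R \<alpha> y g)"
    using quadratic_growth by blast
  have growth_i: "c * (d i)\<^sup>2 \<le> real_objective (y i) (g i) x0 - real_objective (y i) (g i) (x i)" for i
    using growth[OF y(1) g(1) x0, of i] by (simp only: d_sym x_def)
  have growth_0: "c * (d i)\<^sup>2 \<le> real_objective y0 g0 (x i) - real_objective y0 g0 x0" for i
    using growth[OF y(2) g(2) x, of i] by (simp only: d_def x0_def)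
  \<comment> \<open>\<open>e i z\<close> bounds the change of the residual norm at a point of norm \<open>z\<close>.\<close>
  define e where "e i z = C * L2_norm \<Omega> (\<lambda>s. g i s - g0 s) * z + L2_norm \<Omega> (\<lambda>s. y i s - y0 s)" for i z
  have e_lim: "((\<lambda>i. e i z) \<longlongrightarrow> 0) F" for z
    unfolding e_def by (intro tendsto_add_zero tendsto_mult_left_zero tendsto_mult_right_zero y(3) g(3))
  have e_mono: "e i z \<le> e i z'" if "z \<le> z'" for i z z'
    unfolding e_def using that C0
    by (intro add_right_mono mult_left_mono mult_nonneg_nonneg) (simp_all add: L2_norm_nonneg)
  let ?n = "\<lambda>z. L2_norm \<Omega> (\<lambda>s. T g0 z s - y0 s)"
  let ?N = "\<lambda>i z. L2_norm \<Omega> (\<lambda>s. T (g i) z s - y i s)"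
  have N_diff: "\<bar>?N i z - ?n z\<bar> \<le> e i (L2_norm \<Omega> z)" if z: "z \<in> L2 \<Omega>" for i z
  proof -
    note Ti = L2_bilinear_closed[OF T g(1) z, of i] and T0 = L2_bilinear_closed[OF T g(2) z]
    have "\<bar>?N i z - ?n z\<bar> \<le> L2_norm \<Omega> (\<lambda>s. (T (g i) z s - y i s) - (T g0 z s - y0 s))"
      by (rule L2_norm_diff_ineq[OF L2_diff[OF Ti y(1)] L2_diff[OF T0 y(2)]])
    also have "\<dots> = L2_norm \<Omega> (\<lambda>s. (T (g i) z s - T g0 z s) - (y i s - y0 s))"
      by (rule arg_cong[where f = "L2_norm \<Omega>"]) (simp add: fun_eq_iff)
    also have "\<dots> \<le> L2_norm \<Omega> (\<lambda>s. T (g i) z s - T g0 z s) + L2_norm \<Omega> (\<lambda>s. y i s - y0 s)"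
      by (rule L2_norm_diff_le_add[OF L2_diff[OF Ti T0] L2_diff[OF y(1,2)]])
    also have "\<dots> \<le> e i (L2_norm \<Omega> z)"
      using C[OF L2_diff[OF g(1,2)] z, of i]
      by (simp only: L2_bilinear_norm_diff_left[OF T g(1,2) z] e_def add_right_mono)
    finally show ?thesis .
  qed
  \<comment> \<open>The minimizers are eventually bounded, since the value of each objective at \<open>x0\<close> is.\<close>
  obtain D where D: "D \<ge> 0" and dD: "\<forall>\<^sub>F i in F. d i \<le> D"
  proof -
    have "\<forall>\<^sub>F i in F. e i (L2_norm \<Omega> x0) < 1"
      using e_lim by (rule order_tendstoD) simp
    define K where "K = (1 / 2 * (?n x0 + 1)\<^sup>2 + \<alpha> * enn2real (R x0)) / c"
    have "\<forall>\<^sub>F i in F. d i \<le> sqrt K"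
      using \<open>\<forall>\<^sub>F i in F. e i (L2_norm \<Omega> x0) < 1\<close>
    proof eventually_elim
      case (elim i)
      then have "(?N i x0)\<^sup>2 \<le> (?n x0 + 1)\<^sup>2"
        using N_diff[OF x0L2, of i] by (intro power_mono L2_norm_nonneg) linarith
      then have "c * (d i)\<^sup>2 \<le> 1 / 2 * (?n x0 + 1)\<^sup>2 + \<alpha> * enn2real (R x0)"
        using growth_i[of i] real_objective_nonneg[of "y i" "g i" "x i"]
        unfolding real_objective_def[of "y i" "g i" x0] data_fit_def by linarith
      then have "(d i)\<^sup>2 \<le> K"
        unfolding K_def using c by (subst pos_le_divide_eq) (simp_all only: mult.commute)
      then show ?case by (rule real_le_rsqrt)
    qed
    moreover have "0 \<le> sqrt K"
      using c \<alpha> by (simp add: K_def)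
    ultimately show thesis by (rule that[rotated])
  qed
  define B where "B = L2_norm \<Omega> x0 + D"
  define A where "A = C * L2_norm \<Omega> g0 * B + L2_norm \<Omega> y0"
  let ?rhs = "\<lambda>i. (1 / 2 * (e i B * (2 * A + e i B)) + (data_fit (y i) (g i) x0 - data_fit y0 g0 x0)) / (2 * c)"
  have "\<forall>\<^sub>F i in F. norm (d i) \<le> sqrt (?rhs i)"
    using dD
  proof eventually_elim
    case (elim i)
    have xB: "L2_norm \<Omega> (x i) \<le> B"
      using L2_norm_le_norm_diff[OF xL2 x0L2, of i] elim unfolding B_def d_def by linarith
    have N0: "?n (x i) \<le> A"
    proof -
      have "?n (x i) \<le> L2_norm \<Omega> (T g0 (x i)) + L2_norm \<Omega> y0"
        by (rule L2_norm_diff_le_add[OF L2_bilinear_closed[OF T g(2) xL2] y(2)])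
      also have "L2_norm \<Omega> (T g0 (x i)) \<le> C * L2_norm \<Omega> g0 * L2_norm \<Omega> (x i)"
        by (rule C[OF g(2) xL2])
      also have "\<dots> \<le> C * L2_norm \<Omega> g0 * B"
        using C0 by (intro mult_left_mono xB) (simp add: L2_norm_nonneg)
      finally show ?thesis by (simp add: A_def)
    qed
    have eB: "\<bar>?N i (x i) - ?n (x i)\<bar> \<le> e i B"
      using N_diff[OF xL2, of i i] e_mono[OF xB, of i] by linarith
    have "(?n (x i))\<^sup>2 - (?N i (x i))\<^sup>2 = (?n (x i) - ?N i (x i)) * (?n (x i) + ?N i (x i))"
      by (simp add: power2_eq_square algebra_simps)
    also have "\<dots> \<le> e i B * (?n (x i) + ?N i (x i))"
      using eB by (intro mult_right_mono) (simp_all add: L2_norm_nonneg)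
    also have "\<dots> \<le> e i B * (2 * A + e i B)"
      using eB N0 by (intro mult_left_mono) linarith+
    finally have "data_fit y0 g0 (x i) - data_fit (y i) (g i) (x i) \<le> 1 / 2 * (e i B * (2 * A + e i B))"
      unfolding data_fit_def by linarith
    moreover have "2 * (c * (d i)\<^sup>2) \<le> (data_fit y0 g0 (x i) - data_fit (y i) (g i) (x i))
        + (data_fit (y i) (g i) x0 - data_fit y0 g0 x0)"
      using growth_i[of i] growth_0[of i] unfolding real_objective_def by linarith
    ultimately have "2 * (c * (d i)\<^sup>2) \<le> 1 / 2 * (e i B * (2 * A + e i B))
        + (data_fit (y i) (g i) x0 - data_fit y0 g0 x0)"
      by linarith
    then have "(d i)\<^sup>2 \<le> ?rhs i"
      using c by (subst pos_le_divide_eq) (simp, simp only: ac_simps)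
    then show ?case using d0 by (simp add: real_le_rsqrt)
  qed
  moreover have "((\<lambda>i. sqrt (?rhs i)) \<longlongrightarrow> 0) F"
  proof -
    have "((\<lambda>i. ?N i x0 - ?n x0) \<longlongrightarrow> 0) F"
      using N_diff[OF x0L2] by (intro Lim_null_comparison[OF _ e_lim[of "L2_norm \<Omega> x0"]]) simp
    then have "((\<lambda>i. ?N i x0) \<longlongrightarrow> ?n x0) F" by (simp only: LIM_zero_iff)
    then have "((\<lambda>i. data_fit (y i) (g i) x0) \<longlongrightarrow> data_fit y0 g0 x0) F"
      unfolding data_fit_def by (intro tendsto_intros)
    then have "((\<lambda>i. sqrt (?rhs i)) \<longlongrightarrow> sqrt ((1 / 2 * (0 * (2 * A + 0))
        + (data_fit y0 g0 x0 - data_fit y0 g0 x0)) / (2 * c))) F"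
      using c by (intro tendsto_intros e_lim) simp_all
    then show ?thesis by simp
  qed
  ultimately have "(d \<longlongrightarrow> 0) F"
    by (rule Lim_null_comparison)
  then show ?thesis unfolding d_def[abs_def] x_def x0_def .
qed

text \<open>The outer data fit \<open>1/2 \<parallel>T f x\<^sub>g - y\<parallel>\<^sup>2\<close> therefore depends continuously on \<open>y\<close> and \<open>g\<close> in \<open>L\<^sup>2\<close>.\<close>

corollary outer_data_fit_continuous:
  assumes f: "f \<in> L2 \<Omega>"
    and y: "\<And>i. y i \<in> L2 \<Omega>" "y0 \<in> L2 \<Omega>" "((\<lambda>i. L2_norm \<Omega> (\<lambda>s. y i s - y0 s)) \<longlongrightarrow> 0) F"
    and g: "\<And>i. g i \<in> L2 \<Omega>" "g0 \<in> L2 \<Omega>" "((\<lambda>i. L2_norm \<Omega> (\<lambda>s. g i s - g0 s)) \<longlongrightarrow> 0) F"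
  shows "((\<lambda>i. data_fit (y i) f (inner_minimizer \<Omega> T R \<alpha> (y i) (g i))) \<longlongrightarrow>
    data_fit y0 f (inner_minimizer \<Omega> T R \<alpha> y0 g0)) F"
proof -
  define x where "x i = inner_minimizer \<Omega> T R \<alpha> (y i) (g i)" for i
  define x0 where "x0 = inner_minimizer \<Omega> T R \<alpha> y0 g0"
  have x: "x i \<in> L2 \<Omega>" for i unfolding x_def by (rule inner_minimizer_L2[OF y(1) g(1)])
  have x0: "x0 \<in> L2 \<Omega>" unfolding x0_def by (rule inner_minimizer_L2[OF y(2) g(2)])
  have lim: "((\<lambda>i. L2_norm \<Omega> (\<lambda>s. x i s - x0 s)) \<longlongrightarrow> 0) F"
    unfolding x_def x0_def by (rule inner_minimizer_stable[OF y g])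
  obtain C where C: "\<And>g x. g \<in> L2 \<Omega> \<Longrightarrow> x \<in> L2 \<Omega> \<Longrightarrow> L2_norm \<Omega> (T g x) \<le> C * L2_norm \<Omega> g * L2_norm \<Omega> x"
    using L2_bilinear_bound[OF T] by blast
  have "((\<lambda>i. L2_norm \<Omega> (\<lambda>s. (T f (x i) s - y i s) - (T f x0 s - y0 s))) \<longlongrightarrow> 0) F"
  proof (rule Lim_null_comparison)
    show "\<forall>\<^sub>F i in F. norm (L2_norm \<Omega> (\<lambda>s. (T f (x i) s - y i s) - (T f x0 s - y0 s)))
        \<le> C * L2_norm \<Omega> f * L2_norm \<Omega> (\<lambda>s. x i s - x0 s) + L2_norm \<Omega> (\<lambda>s. y i s - y0 s)"
    proof (intro always_eventually allI)
      fix i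
      note Ti = L2_bilinear_closed[OF T f x, of i] and T0 = L2_bilinear_closed[OF T f x0]
      have "L2_norm \<Omega> (\<lambda>s. (T f (x i) s - y i s) - (T f x0 s - y0 s)) =
          L2_norm \<Omega> (\<lambda>s. (T f (x i) s - T f x0 s) - (y i s - y0 s))"
        by (rule arg_cong[where f = "L2_norm \<Omega>"]) (simp add: fun_eq_iff)
      also have "\<dots> \<le> L2_norm \<Omega> (\<lambda>s. T f (x i) s - T f x0 s) + L2_norm \<Omega> (\<lambda>s. y i s - y0 s)"
        by (rule L2_norm_diff_le_add[OF L2_diff[OF Ti T0] L2_diff[OF y(1,2)]])
      also have "L2_norm \<Omega> (\<lambda>s. T f (x i) s - T f x0 s) \<le> C * L2_norm \<Omega> f * L2_norm \<Omega> (\<lambda>s. x i s - x0 s)"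
        unfolding L2_bilinear_norm_diff_right[OF T f x x0] by (rule C[OF f L2_diff[OF x x0]])
      finally show "norm (L2_norm \<Omega> (\<lambda>s. (T f (x i) s - y i s) - (T f x0 s - y0 s)))
          \<le> C * L2_norm \<Omega> f * L2_norm \<Omega> (\<lambda>s. x i s - x0 s) + L2_norm \<Omega> (\<lambda>s. y i s - y0 s)"
        by (simp add: L2_norm_nonneg)
    qed
    show "((\<lambda>i. C * L2_norm \<Omega> f * L2_norm \<Omega> (\<lambda>s. x i s - x0 s) + L2_norm \<Omega> (\<lambda>s. y i s - y0 s)) \<longlongrightarrow> 0) F"
      by (intro tendsto_add_zero tendsto_mult_right_zero lim y(3))
  qed
  then have "((\<lambda>i. L2_norm \<Omega> (\<lambda>s. T f (x i) s - y i s)) \<longlongrightarrow> L2_norm \<Omega> (\<lambda>s. T f x0 s - y0 s)) F"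
    by (intro L2_norm_tendsto L2_diff L2_bilinear_closed[OF T] f x x0 y)
  then show ?thesis
    unfolding data_fit_def x_def x0_def by (intro tendsto_intros)
qed

end

section \<open>Smooth bump functions\<close>

text \<open>The polynomials \<open>P\<^sub>k\<close> for which \<open>P\<^sub>k(1/t) exp(-1/t)\<close> is the \<open>k\<close>-th derivative of \<open>exp(-1/t)\<close>.\<close>

primrec flat_poly :: "nat \<Rightarrow> real poly" where
  "flat_poly 0 = 1"
| "flat_poly (Suc k) = [:0, 0, 1:] * (flat_poly k - pderiv (flat_poly k))"

text \<open>The \<open>k\<close>-th derivative of the smooth function that is \<open>exp(-1/t)\<close> for \<open>t > 0\<close> and \<open>0\<close> elsewhere.\<close>

definition flat :: "nat \<Rightarrow> real \<Rightarrow> real" where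
  "flat k t = (if t > 0 then poly (flat_poly k) (1 / t) * exp (- 1 / t) else 0)"

lemma poly_times_exp_minus_tendsto_0:
  "((\<lambda>x::real. poly p x * exp (- x)) \<longlongrightarrow> 0) at_top"
proof -
  have "((\<lambda>x::real. \<Sum>i\<le>degree p. coeff p i * (x ^ i / exp x)) \<longlongrightarrow> 0) at_top"
    by (intro tendsto_null_sum tendsto_mult_right_zero tendsto_power_div_exp_0)
  then show ?thesis
    by (simp add: poly_altdef sum_distrib_right exp_minus divide_inverse mult.assoc)
qed

text \<open>At \<open>t = 0\<close> the difference quotient is \<open>x P(x) exp(-x)\<close> with \<open>x = 1/t\<close>, which tends to \<open>0\<close>.\<close>

lemma flat_has_derivative:
  "(flat k has_real_derivative flat (Suc k) t) (at t)"
proof (cases "t > 0")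
  case True
  have "((\<lambda>t. poly (flat_poly k) (1 / t) * exp (- 1 / t)) has_real_derivative flat (Suc k) t) (at t)"
    using True by (auto intro!: derivative_eq_intros simp: flat_def power2_eq_square field_simps)
  moreover have "\<forall>\<^sub>F x in nhds t. flat k x = poly (flat_poly k) (1 / x) * exp (- 1 / x)"
    using True eventually_nhds_in_open[of "{0<..}" t]
    by (auto simp: flat_def elim!: eventually_mono)
  ultimately show ?thesis
    by (subst DERIV_cong_ev[OF refl _ refl]) auto
next
  case False
  have "((\<lambda>x. (flat k x - flat k t) / (x - t)) \<longlongrightarrow> 0) (at t)"
  proof (cases "t = 0")
    case True
    have "((\<lambda>x. poly ([:0, 1:] * flat_poly k) (inverse x) * exp (- inverse x)) \<longlongrightarrow> 0) (at_right (0::real))"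
      by (rule filterlim_compose[OF poly_times_exp_minus_tendsto_0 filterlim_inverse_at_top_right])
    then have "((\<lambda>x. flat k x / x) \<longlongrightarrow> 0) (at_right 0)"
      by (rule Lim_transform_eventually)
         (auto simp: flat_def eventually_at_filter divide_inverse mult_ac)
    moreover have "((\<lambda>x. flat k x / x) \<longlongrightarrow> 0) (at_left 0)"
      by (rule tendsto_eventually) (auto simp: flat_def eventually_at_filter)
    ultimately show ?thesis
      using True by (simp add: filterlim_split_at flat_def[of k 0])
  next
    case False
    with \<open>\<not> t > 0\<close> have "t < 0" by simp
    then have "\<forall>\<^sub>F x in at t. x < 0"
      using order_tendstoD(2)[OF tendsto_ident_at] by blast
    then have "\<forall>\<^sub>F x in at t. (flat k x - flat k t) / (x - t) = 0"
      by eventually_elim (use \<open>t < 0\<close> in \<open>simp add: flat_def\<close>)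
    then show ?thesis by (rule tendsto_eventually)
  qed
  then show ?thesis
    using False by (simp add: has_field_derivative_iff flat_def[of "Suc k"])
qed

text \<open>The algebra generated by the functions \<open>flat k\<close> composed with affine functions. It is closed under
  partial derivatives, which makes its elements smooth in the sense of \<^const>\<open>C_k\<close> for every \<open>k\<close>.\<close>

inductive_set flat_algebra :: "('a::euclidean_space \<Rightarrow> real) set" where
  gen: "(\<lambda>s. flat k (s \<bullet> v + c)) \<in> flat_algebra"
| const: "(\<lambda>s. c) \<in> flat_algebra"
| add: "\<phi> \<in> flat_algebra \<Longrightarrow> \<psi> \<in> flat_algebra \<Longrightarrow> (\<lambda>s. \<phi> s + \<psi> s) \<in> flat_algebra"
| mult: "\<phi> \<in> flat_algebra \<Longrightarrow> \<psi> \<in> flat_algebra \<Longrightarrow> (\<lambda>s. \<phi> s * \<psi> s) \<in> flat_algebra"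

lemma flat_algebra_derivative:
  assumes "\<phi> \<in> flat_algebra"
  shows "\<exists>D. (\<forall>s. (\<phi> has_derivative D s) (at s)) \<and> (\<forall>i. (\<lambda>s. D s i) \<in> flat_algebra)"
  using assms
proof induction
  case (gen k v c)
  let ?D = "\<lambda>s i. flat (Suc k) (s \<bullet> v + c) * (i \<bullet> v)"
  have "((\<lambda>s. flat k (s \<bullet> v + c)) has_derivative ?D s) (at s)" for s
    by (rule has_derivative_compose[OF _ flat_has_derivative[unfolded has_field_derivative_def]])
       (auto intro!: derivative_eq_intros)
  moreover have "(\<lambda>s. ?D s i) \<in> flat_algebra" for i
    by (intro flat_algebra.intros)
  ultimately show ?case by (intro exI[of _ ?D]) simp
next
  case (const c)
  show ?case
    by (rule exI[of _ "\<lambda>s i. 0"]) (auto intro: flat_algebra.intros)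
next
  case (add \<phi> \<psi>)
  then obtain D E where "\<And>s. (\<phi> has_derivative D s) (at s)" "\<And>i. (\<lambda>s. D s i) \<in> flat_algebra"
    "\<And>s. (\<psi> has_derivative E s) (at s)" "\<And>i. (\<lambda>s. E s i) \<in> flat_algebra" by metis
  then show ?case
    by (intro exI[of _ "\<lambda>s i. D s i + E s i"])
       (auto intro!: flat_algebra.intros derivative_intros)
next
  case (mult \<phi> \<psi>)
  then obtain D E where "\<And>s. (\<phi> has_derivative D s) (at s)" "\<And>i. (\<lambda>s. D s i) \<in> flat_algebra"
    "\<And>s. (\<psi> has_derivative E s) (at s)" "\<And>i. (\<lambda>s. E s i) \<in> flat_algebra" by metis
  then show ?case
    using mult.hyps by (intro exI[of _ "\<lambda>s i. \<phi> s * E s i + D s i * \<psi> s"])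
       (auto intro!: flat_algebra.intros has_derivative_mult)
qed

lemma flat_algebra_C_k:
  "\<phi> \<in> flat_algebra \<Longrightarrow> C_k k \<phi>"
proof (induction k arbitrary: \<phi>)
  case 0
  then obtain D where "\<And>s. (\<phi> has_derivative D s) (at s)"
    using flat_algebra_derivative by blast
  then show ?case
    unfolding C_k.simps by (meson continuous_at_imp_continuous_on has_derivative_continuous)
next
  case (Suc k)
  obtain D where D: "\<And>s. (\<phi> has_derivative D s) (at s)" "\<And>i. (\<lambda>s. D s i) \<in> flat_algebra"
    using flat_algebra_derivative[OF Suc.prems] by blast
  have "frechet_derivative \<phi> (at s) = D s" for s
    using frechet_derivative_at[OF D(1)] by simp
  then show ?case
    using D Suc.IH by (auto simp: differentiable_def)
qed

text \<open>Smooth functions supported in the box with corners \<open>a\<close> and \<open>b\<close>. Since \<open>exp(-1/(n t)) \<longlonglongrightarrow> 1\<close>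
  for \<open>t > 0\<close>, they converge pointwise to the indicator function of the open box.\<close>

definition box_bump :: "'a::euclidean_space \<Rightarrow> 'a \<Rightarrow> nat \<Rightarrow> 'a \<Rightarrow> real" where
  "box_bump a b n s =
     (\<Prod>i\<in>Basis. flat 0 (real n * (s \<bullet> i - a \<bullet> i)) * flat 0 (real n * (b \<bullet> i - s \<bullet> i)))"

lemma flat_algebra_prod:
  "finite I \<Longrightarrow> (\<And>i. i \<in> I \<Longrightarrow> \<phi> i \<in> flat_algebra) \<Longrightarrow> (\<lambda>s. \<Prod>i\<in>I. \<phi> i s) \<in> flat_algebra"
  by (induction I rule: finite_induct) (auto intro: flat_algebra.intros)

lemma box_bump_flat_algebra: "box_bump a b n \<in> flat_algebra"
proof -
  have 1: "(\<lambda>s. flat 0 (real n * (s \<bullet> i - a \<bullet> i))) \<in> flat_algebra" for i :: 'a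
    using flat_algebra.gen[of 0 "real n *\<^sub>R i" "- (real n * (a \<bullet> i))"] by (simp add: algebra_simps)
  have 2: "(\<lambda>s. flat 0 (real n * (b \<bullet> i - s \<bullet> i))) \<in> flat_algebra" for i :: 'a
    using flat_algebra.gen[of 0 "- (real n *\<^sub>R i)" "real n * (b \<bullet> i)"] by (simp add: algebra_simps)
  have "(\<lambda>s. box_bump a b n s) \<in> flat_algebra"
    unfolding box_bump_def by (intro flat_algebra_prod flat_algebra.mult 1 2) simp
  then show ?thesis by simp
qed

lemma flat_0_bounds: "0 \<le> flat 0 t" "flat 0 t \<le> 1"
  by (auto simp: flat_def)

lemma flat_0_nonpos: "t \<le> 0 \<Longrightarrow> flat 0 t = 0"
  by (auto simp: flat_def)

lemma box_bump_bounds: "0 \<le> box_bump a b n s" "box_bump a b n s \<le> 1"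
  unfolding box_bump_def
  by (auto intro!: prod_nonneg prod_le_1 mult_nonneg_nonneg mult_le_one simp: flat_0_bounds)

lemma box_bump_eq_0: "s \<notin> box a b \<Longrightarrow> box_bump a b n s = 0"
  by (auto simp: mem_box box_bump_def flat_0_nonpos not_less mult_nonneg_nonpos intro!: bexI)

lemma flat_0_scale_tendsto:
  assumes "t > 0"
  shows "(\<lambda>n. flat 0 (real n * t)) \<longlonglongrightarrow> 1"
proof -
  have "(\<lambda>n. exp (- (1 / t) * inverse (real n))) \<longlonglongrightarrow> exp (- (1 / t) * 0)"
    by (intro tendsto_intros lim_inverse_n)
  moreover have "\<forall>\<^sub>F n in sequentially. exp (- (1 / t) * inverse (real n)) = flat 0 (real n * t)"
    using eventually_gt_at_top[of 0] by eventually_elim (use assms in \<open>simp add: flat_def field_simps\<close>)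
  ultimately show ?thesis
    using Lim_transform_eventually by fastforce
qed

lemma box_bump_tendsto: "(\<lambda>n. box_bump a b n s) \<longlonglongrightarrow> indicator (box a b) s"
proof (cases "s \<in> box a b")
  case True
  have "(\<lambda>n. box_bump a b n s) \<longlonglongrightarrow> (\<Prod>i\<in>(Basis::'a set). 1 * 1)"
    unfolding box_bump_def using True
    by (intro tendsto_prod tendsto_mult flat_0_scale_tendsto) (auto simp: mem_box)
  then show ?thesis using True by simp
qed (simp add: box_bump_eq_0)

lemma box_bump_test_function:
  assumes "cbox a b \<subseteq> \<Omega>"
  shows "test_function \<Omega> (box_bump a b n)"
proof -
  have "{s. box_bump a b n s \<noteq> 0} \<subseteq> cbox a b"
    using box_bump_eq_0 box_subset_cbox by blast
  then have "closure {s. box_bump a b n s \<noteq> 0} \<subseteq> cbox a b"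
    by (rule closure_minimal) (rule closed_cbox)
  moreover from this have "compact (closure {s. box_bump a b n s \<noteq> 0})"
    using compact_Int_closed[OF compact_cbox closed_closure] by (metis inf.absorb2)
  ultimately show ?thesis
    unfolding test_function_def
    using assms flat_algebra_C_k[OF box_bump_flat_algebra] by blast
qed

section \<open>Uniqueness of weak derivatives\<close>

lemma test_function_continuous: "test_function \<Omega> \<phi> \<Longrightarrow> continuous_on UNIV \<phi>"
  unfolding test_function_def using C_k.simps(1) by blast

lemma test_function_derivative_continuous:
  assumes "test_function \<Omega> \<phi>" "i \<in> Basis"
  shows "continuous_on UNIV (\<lambda>s. frechet_derivative \<phi> (at s) i)"
  using assms unfolding test_function_def by (metis C_k.simps)

lemma test_function_derivative_eq_0:
  assumes "s \<notin> closure {s. \<phi> s \<noteq> 0}"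
  shows "frechet_derivative \<phi> (at s) i = (0::real)"
proof -
  have "(\<phi> has_derivative (\<lambda>h. 0)) (at s)"
  proof (rule has_derivative_transform_within_open[where s = "- closure {s. \<phi> s \<noteq> 0}"])
    show "\<And>x. x \<in> - closure {s. \<phi> s \<noteq> 0} \<Longrightarrow> 0 = \<phi> x"
      using closure_subset by force
  qed (use assms in \<open>auto intro: has_derivative_const\<close>)
  then show ?thesis
    by (simp flip: frechet_derivative_at)
qed

lemma continuous_compact_support_L2:
  assumes "\<Omega> \<in> sets lebesgue" "continuous_on UNIV \<phi>" "compact K" "\<And>s. s \<notin> K \<Longrightarrow> \<phi> s = 0"
  shows "\<phi> \<in> L2 \<Omega>"
proof -
  have bm: "\<phi> \<in> borel_measurable borel"
    using assms(2) by (rule borel_measurable_continuous_onI)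
  have "bounded (\<phi> ` K)"
    by (intro compact_imp_bounded compact_continuous_image continuous_on_subset[OF assms(2)] assms(3)) simp
  then obtain B where B: "\<And>s. s \<in> K \<Longrightarrow> \<bar>\<phi> s\<bar> \<le> B"
    by (auto simp: bounded_iff)
  have meas: "\<phi> \<in> borel_measurable (lebesgue_on \<Omega>)"
    using bm by (intro measurable_restrict_space1 measurable_completion) simp
  have "integrable (lebesgue_on \<Omega>) (\<lambda>s. (\<phi> s)\<^sup>2)"
  proof (rule integrableI_bounded_set[where A = "K \<inter> \<Omega>" and B = "B\<^sup>2"])
    show "K \<inter> \<Omega> \<in> sets (lebesgue_on \<Omega>)"
      using assms(1,3) by (auto simp: sets_restrict_space compact_imp_closed intro!: lmeasurable_compact fmeasurableD)
    have "emeasure (lebesgue_on \<Omega>) (K \<inter> \<Omega>) = emeasure lebesgue (K \<inter> \<Omega>)"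
      using assms(1) by (intro emeasure_restrict_space) auto
    also have "\<dots> \<le> emeasure lebesgue K"
      using lmeasurable_compact[OF assms(3)] by (intro emeasure_mono) (auto dest: fmeasurableD)
    also have "\<dots> < \<infinity>"
      using fmeasurableD2[OF lmeasurable_compact[OF assms(3)]] by (simp only: infinity_ennreal_def less_top)
    finally show "emeasure (lebesgue_on \<Omega>) (K \<inter> \<Omega>) < \<infinity>" .
    show "AE s in lebesgue_on \<Omega>. s \<in> K \<inter> \<Omega> \<longrightarrow> norm ((\<phi> s)\<^sup>2) \<le> B\<^sup>2"
      using B by (intro AE_I2) (auto intro!: abs_le_square_iff[THEN iffD1] intro: order_trans[OF B abs_ge_self])
    show "AE s in lebesgue_on \<Omega>. s \<notin> K \<inter> \<Omega> \<longrightarrow> (\<phi> s)\<^sup>2 = 0"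
      using assms(4) by (intro AE_I2) auto
  qed (use meas in measurable)
  with meas show ?thesis by (simp add: L2_def)
qed

lemma test_function_L2:
  assumes "\<Omega> \<in> sets lebesgue" "test_function \<Omega> \<phi>"
  shows "\<phi> \<in> L2 \<Omega>"
proof (rule continuous_compact_support_L2[OF assms(1) test_function_continuous[OF assms(2)]])
  show "compact (closure {s. \<phi> s \<noteq> 0})" using assms(2) by (simp add: test_function_def)
  show "\<phi> s = 0" if "s \<notin> closure {s. \<phi> s \<noteq> 0}" for s
    using that closure_subset by force
qed

lemma test_function_derivative_L2:
  assumes "\<Omega> \<in> sets lebesgue" "test_function \<Omega> \<phi>" "i \<in> Basis"
  shows "(\<lambda>s. frechet_derivative \<phi> (at s) i) \<in> L2 \<Omega>"
proof (rule continuous_compact_support_L2[OF assms(1) test_function_derivative_continuous[OF assms(2,3)]])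
  show "compact (closure {s. \<phi> s \<noteq> 0})" using assms(2) by (simp add: test_function_def)
qed (rule test_function_derivative_eq_0)

text \<open>An integrable function vanishes almost everywhere if its integral over the whole space and over
  every open box is zero: the sets over which the integral is zero form a Dynkin system.\<close>

lemma integral_boxes_zero_imp_AE_zero:
  fixes f :: "'a::euclidean_space \<Rightarrow> real"
  assumes f: "integrable lebesgue f"
    and boxes: "\<And>a b. (\<integral>s. indicator (box a b) s * f s \<partial>lebesgue) = 0"
    and total: "(\<integral>s. f s \<partial>lebesgue) = 0"
  shows "AE s in lebesgue. f s = 0"
proof -
  obtain g where g[measurable]: "g \<in> borel_measurable lborel" and fg: "AE s in lborel. f s = g s"
    using completion_ex_borel_measurable_real[OF borel_measurable_integrable[OF f]] by blast
  have fg': "AE s in lebesgue. f s = g s" using fg by (rule AE_completion)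
  have [measurable]: "g \<in> borel_measurable lebesgue" using g by (rule measurable_completion)
  have "integrable lebesgue g"
    by (rule integrable_cong_AE_imp[OF f _ fg']) measurable
  then have g_int: "integrable lborel g" by (simp add: integrable_completion)
  have [measurable]: "f \<in> borel_measurable lebesgue" using f by simp
  have transfer: "(\<integral>s. indicator A s * g s \<partial>lborel) = (\<integral>s. indicator A s * f s \<partial>lebesgue)"
    if A: "A \<in> sets borel" for A
  proof -
    have [measurable]: "A \<in> sets lebesgue" "A \<in> sets lborel" using A by auto
    have "(\<integral>s. indicator A s * f s \<partial>lebesgue) = (\<integral>s. indicator A s * g s \<partial>lebesgue)"
      using fg' by (intro integral_cong_AE) (auto elim: eventually_mono)
    also have "\<dots> = (\<integral>s. indicator A s * g s \<partial>lborel)"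
      by (rule integral_completion) measurable
    finally show ?thesis by simp
  qed
  have "(\<integral>s\<in>A. g s \<partial>lborel) = 0" if A: "A \<in> sets borel" for A
  proof -
    have A': "A \<in> sigma_sets UNIV (range (\<lambda>(a, b). box a b))"
      using A unfolding borel_eq_box by simp
    show ?thesis
    proof (rule sigma_sets_induct_disjoint[OF _ _ A'])
      show "Int_stable (range (\<lambda>(a, b). box a b) :: 'a set set)"
        by (auto simp: Int_stable_def box_Int_box)
      show "range (\<lambda>(a, b). box a b) \<subseteq> Pow (UNIV :: 'a set)" by simp
      show "(\<integral>s\<in>X. g s \<partial>lborel) = 0" if X: "X \<in> range (\<lambda>(a, b). box a b)" for X
        using X boxes transfer by (auto simp: set_lebesgue_integral_def)
      show "(\<integral>s\<in>{}. g s \<partial>lborel) = 0" by (simp add: set_lebesgue_integral_def)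
    next
      fix X :: "'a set"
      assume X: "X \<in> sigma_sets UNIV (range (\<lambda>(a, b). box a b))" "(\<integral>s\<in>X. g s \<partial>lborel) = 0"
      have [measurable]: "X \<in> sets borel" using X(1) unfolding borel_eq_box by simp
      have tot: "(\<integral>s. g s \<partial>lborel) = 0"
        using transfer[of UNIV] total by simp
      have "(\<integral>s\<in>UNIV - X. g s \<partial>lborel) = (\<integral>s. g s - indicator X s * g s \<partial>lborel)"
        unfolding set_lebesgue_integral_def
        by (intro Bochner_Integration.integral_cong) (auto simp: indicator_def)
      also have "\<dots> = (\<integral>s. g s \<partial>lborel) - (\<integral>s. indicator X s * g s \<partial>lborel)"
        using g_int integrable_mult_indicator[of X lborel g]
        by (intro Bochner_Integration.integral_diff) simp_all
      also have "\<dots> = 0" using tot X(2) by (simp add: set_lebesgue_integral_def)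
      finally show "(\<integral>s\<in>UNIV - X. g s \<partial>lborel) = 0" .
    next
      fix X :: "nat \<Rightarrow> 'a set"
      assume X: "disjoint_family X" "range X \<subseteq> sigma_sets UNIV (range (\<lambda>(a, b). box a b))"
        "\<And>i. (\<integral>s\<in>X i. g s \<partial>lborel) = 0"
      have [measurable]: "X i \<in> sets borel" for i using X(2) unfolding borel_eq_box by auto
      have "(\<integral>s\<in>(\<Union>i. X i). g s \<partial>lborel) = (\<Sum>i. \<integral>s\<in>X i. g s \<partial>lborel)"
      proof (rule lebesgue_integral_countable_add)
        show "set_integrable lborel (\<Union>i. X i) g"
          unfolding set_integrable_def by (rule integrable_mult_indicator[OF _ g_int]) simp
      qed (use X(1) in \<open>auto simp: disjoint_family_on_def\<close>)
      then show "(\<integral>s\<in>(\<Union>i. X i). g s \<partial>lborel) = 0" using X(3) by simp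
    qed
  qed
  then have "AE s in lborel. g s = 0"
    using density_unique_real[OF g_int, of "\<lambda>s. 0"] by simp
  then have "AE s in lborel. f s = 0"
    using fg by eventually_elim simp
  then show ?thesis by (rule AE_completion)
qed

text \<open>The fundamental lemma of the calculus of variations. Testing with the bump functions shows that
  the integral of \<open>w\<close> over every box with closure in \<open>\<Omega>\<close> vanishes, and \<open>\<Omega>\<close> is a countable union of
  closed boxes.\<close>

theorem fundamental_lemma:
  fixes w :: "'a::euclidean_space \<Rightarrow> real"
  assumes \<Omega>: "open \<Omega>" and w: "w \<in> L2 \<Omega>"
    and test: "\<And>\<phi>. test_function \<Omega> \<phi> \<Longrightarrow> (\<integral>s. w s * \<phi> s \<partial>lebesgue_on \<Omega>) = 0"
  shows "AE s in lebesgue_on \<Omega>. w s = 0"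
proof -
  have \<Omega>_meas[measurable]: "\<Omega> \<in> sets lebesgue" using \<Omega> by simp
  note [measurable] = L2_D(1)[OF w]
  have one_L2: "indicator (cbox a b) \<in> L2 \<Omega>" for a b
  proof -
    have 1: "integrable lebesgue (indicator (cbox a b) :: 'a \<Rightarrow> real)"
      by (simp add: lmeasurable_iff_integrable[symmetric])
    have "integrable lebesgue (\<lambda>s. indicator \<Omega> s *\<^sub>R (indicator (cbox a b) s :: real))"
      by (rule integrable_mult_indicator[OF \<Omega>_meas 1])
    then have "integrable (lebesgue_on \<Omega>) (indicator (cbox a b) :: 'a \<Rightarrow> real)"
      by (simp add: integrable_restrict_space)
    moreover from this have "(indicator (cbox a b) :: 'a \<Rightarrow> real) \<in> borel_measurable (lebesgue_on \<Omega>)"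
      by (rule borel_measurable_integrable)
    moreover have "(indicator (cbox a b) s :: real)\<^sup>2 = indicator (cbox a b) s" for s :: 'a
      by (simp add: indicator_def)
    ultimately show ?thesis by (simp add: L2_def)
  qed
  have int: "integrable (lebesgue_on \<Omega>) (\<lambda>s. w s * indicator (cbox a b) s)" for a b
    by (rule L2_mult_integrable[OF w one_L2])
  have box0: "(\<integral>s. w s * indicator (box a b) s \<partial>lebesgue_on \<Omega>) = 0" if ab: "cbox a b \<subseteq> \<Omega>" for a b
  proof -
    have "(\<lambda>n. \<integral>s. w s * box_bump a b n s \<partial>lebesgue_on \<Omega>) \<longlonglongrightarrow>
        (\<integral>s. w s * indicator (box a b) s \<partial>lebesgue_on \<Omega>)"
    proof (rule integral_dominated_convergence[where w = "\<lambda>s. norm (w s * indicator (cbox a b) s)"])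
      have "indicator (box a b) \<in> borel_measurable (lebesgue_on \<Omega>)"
        by (intro measurable_restrict_space1 borel_measurable_indicator) simp
      then show "(\<lambda>s. w s * indicator (box a b) s) \<in> borel_measurable (lebesgue_on \<Omega>)"
        by (intro borel_measurable_times L2_D(1)[OF w])
      show "(\<lambda>s. w s * box_bump a b n s) \<in> borel_measurable (lebesgue_on \<Omega>)" for n
        using L2_D(1)[OF test_function_L2[OF \<Omega>_meas box_bump_test_function[OF ab]]] by measurable
      show "AE s in lebesgue_on \<Omega>. (\<lambda>n. w s * box_bump a b n s) \<longlonglongrightarrow> w s * indicator (box a b) s"
        by (intro AE_I2 tendsto_intros box_bump_tendsto)
      show "AE s in lebesgue_on \<Omega>. norm (w s * box_bump a b n s) \<le> norm (w s * indicator (cbox a b) s)" for n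
      proof (intro AE_I2)
        fix s
        show "norm (w s * box_bump a b n s) \<le> norm (w s * indicator (cbox a b) s)"
        proof (cases "s \<in> box a b")
          case True
          then have "s \<in> cbox a b" using box_subset_cbox by blast
          then show ?thesis
            using box_bump_bounds[of a b n s] by (simp add: abs_mult mult_left_le)
        qed (simp add: box_bump_eq_0)
      qed
    qed (intro integrable_norm int)
    then show ?thesis
      by (simp add: test[OF box_bump_test_function[OF ab]] LIMSEQ_const_iff)
  qed
  have AE_cbox: "AE s in lebesgue. s \<in> cbox c d \<longrightarrow> w s = 0" if cd: "cbox c d \<subseteq> \<Omega>" for c d
  proof -
    let ?f = "\<lambda>s. indicator (cbox c d) s * w s"
    have restrict: "indicator \<Omega> s *\<^sub>R (w s * indicator (cbox c d) s) = ?f s" for s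
      using cd by (auto simp: indicator_def)
    have f: "integrable lebesgue ?f"
    proof -
      have "integrable lebesgue (\<lambda>s. indicator \<Omega> s *\<^sub>R (w s * indicator (cbox c d) s))"
        using int[of c d] by (subst (asm) integrable_restrict_space) simp_all
      then show ?thesis by (simp only: restrict)
    qed
    have null: "AE s in lebesgue. s \<notin> cbox c d - box c d"
      using negligible_frontier_interval[of c d] by (intro AE_not_in) (simp add: negligible_iff_null_sets)
    have f_meas: "?f \<in> borel_measurable lebesgue" using f by (rule borel_measurable_integrable)
    have *: "(\<integral>s. indicator B s * ?f s \<partial>lebesgue) = 0"
      if B: "B = box a b \<or> B = UNIV" for a b B
    proof -
      \<comment> \<open>\<open>B\<close> meets the open box \<open>box c d\<close> in a box whose closure stays in \<open>\<Omega>\<close>.\<close>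
      obtain p q where pq: "B \<inter> box c d = box p q" "cbox p q \<subseteq> \<Omega>"
      proof (cases "B \<inter> box c d = {}")
        case True
        obtain i :: 'a where "i \<in> Basis" using nonempty_Basis by blast
        then have "box i 0 = {}" "cbox i 0 = {}" by (auto simp: box_eq_empty intro!: bexI[of _ i])
        then show ?thesis using that[of i 0] True by simp
      next
        case False
        obtain p q where pq: "B \<inter> box c d = box p q"
          using B by (auto simp: box_Int_box)
        then have "box p q \<noteq> {}" "box p q \<subseteq> cbox c d"
          using False box_subset_cbox by auto
        then have "cbox p q \<subseteq> cbox c d"
          by (metis closed_cbox closure_box closure_minimal)
        then show ?thesis using that pq cd by blast
      qed
      have "B \<in> sets lebesgue" using B by auto
      have "(\<integral>s. indicator B s * ?f s \<partial>lebesgue) =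
          (\<integral>s. indicator \<Omega> s *\<^sub>R (w s * indicator (box p q) s) \<partial>lebesgue)"
      proof (rule integral_cong_AE)
        have eq: "indicator B s * ?f s = indicator \<Omega> s *\<^sub>R (w s * indicator (box p q) s)"
          if "s \<notin> cbox c d - box c d" for s
          using that pq cd box_subset_cbox[of c d] box_subset_cbox[of p q]
          by (auto simp: indicator_def set_eq_iff subset_eq)
        show "AE s in lebesgue. indicator B s * ?f s = indicator \<Omega> s *\<^sub>R (w s * indicator (box p q) s)"
          using null by eventually_elim (rule eq)
        have "(\<lambda>s. indicator (box p q) s * ?f s) \<in> borel_measurable lebesgue"
          by (intro borel_measurable_times borel_measurable_indicator f_meas) simp
        also have "(\<lambda>s. indicator (box p q) s * ?f s) = (\<lambda>s. indicator \<Omega> s *\<^sub>R (w s * indicator (box p q) s))"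
          using pq(1) cd box_subset_cbox[of c d] by (auto simp: indicator_def fun_eq_iff)
        finally show "(\<lambda>s. indicator \<Omega> s *\<^sub>R (w s * indicator (box p q) s)) \<in> borel_measurable lebesgue" .
      qed (intro borel_measurable_times borel_measurable_indicator f_meas \<open>B \<in> sets lebesgue\<close>)
      also have "\<dots> = 0"
        using box0[OF pq(2)] by (simp add: integral_restrict_space)
      finally show ?thesis .
    qed
    have "AE s in lebesgue. ?f s = 0"
      using integral_boxes_zero_imp_AE_zero[OF f] * *[of UNIV] by simp
    then show ?thesis by eventually_elim (auto simp: indicator_def split: if_splits)
  qed
  obtain \<D> where D: "countable \<D>" "\<D> \<subseteq> Pow \<Omega>" "\<And>X. X \<in> \<D> \<Longrightarrow> \<exists>a b. X = cbox a b" "\<Union>\<D> = \<Omega>"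
    using open_countable_Union_open_cbox[OF \<Omega>] by blast
  have "AE s in lebesgue. \<forall>X\<in>\<D>. s \<in> X \<longrightarrow> w s = 0"
  proof (subst AE_ball_countable[OF D(1)], rule ballI)
    fix X assume "X \<in> \<D>"
    then obtain a b where "X = cbox a b" "cbox a b \<subseteq> \<Omega>" using D by blast
    then show "AE s in lebesgue. s \<in> X \<longrightarrow> w s = 0" using AE_cbox by simp
  qed
  then have "AE s in lebesgue. s \<in> \<Omega> \<longrightarrow> w s = 0"
    by eventually_elim (use D(4) in blast)
  then show ?thesis
    by (subst AE_restrict_space_iff) simp_all
qed

lemma weak_partial_unique:
  assumes \<Omega>: "open \<Omega>" and w: "w \<in> L2 \<Omega>" "w' \<in> L2 \<Omega>"
    and "is_weak_partial \<Omega> i u w" "is_weak_partial \<Omega> i u w'"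
  shows "eq_AE \<Omega> w w'"
proof -
  have "AE s in lebesgue_on \<Omega>. w s - w' s = 0"
  proof (rule fundamental_lemma[OF \<Omega> L2_diff[OF w]])
    fix \<phi> assume \<phi>: "test_function \<Omega> \<phi>"
    have \<phi>L2: "\<phi> \<in> L2 \<Omega>" using \<Omega> by (intro test_function_L2 \<phi>) simp
    have "(\<integral>s. w s * \<phi> s \<partial>lebesgue_on \<Omega>) = (\<integral>s. w' s * \<phi> s \<partial>lebesgue_on \<Omega>)"
      using assms(4,5) \<phi> unfolding is_weak_partial_def by (metis minus_equation_iff)
    then show "(\<integral>s. (w s - w' s) * \<phi> s \<partial>lebesgue_on \<Omega>) = 0"
      using L2_mult_integrable[OF w(1) \<phi>L2] L2_mult_integrable[OF w(2) \<phi>L2]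
      by (simp add: left_diff_distrib)
  qed
  then show ?thesis by (simp add: eq_AE_def)
qed

section \<open>The Sobolev space\<close>

lemma W12_L2: "u \<in> W12 \<Omega> \<Longrightarrow> u \<in> L2 \<Omega>"
  by (simp add: W12_def)

lemma weak_partial:
  assumes "u \<in> W12 \<Omega>" "i \<in> Basis"
  shows weak_partial_L2: "weak_partial \<Omega> i u \<in> L2 \<Omega>"
    and weak_partial_is_weak_partial: "is_weak_partial \<Omega> i u (weak_partial \<Omega> i u)"
proof -
  have "\<exists>w. w \<in> L2 \<Omega> \<and> is_weak_partial \<Omega> i u w"
    using assms by (auto simp: W12_def)
  then have "weak_partial \<Omega> i u \<in> L2 \<Omega> \<and> is_weak_partial \<Omega> i u (weak_partial \<Omega> i u)"
    unfolding weak_partial_def by (rule someI_ex)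
  then show "weak_partial \<Omega> i u \<in> L2 \<Omega>" "is_weak_partial \<Omega> i u (weak_partial \<Omega> i u)" by auto
qed

lemma is_weak_partial_lincomb:
  assumes "\<Omega> \<in> sets lebesgue" "i \<in> Basis"
    and u: "u \<in> L2 \<Omega>" "u' \<in> L2 \<Omega>" and w: "w \<in> L2 \<Omega>" "w' \<in> L2 \<Omega>"
    and partial: "is_weak_partial \<Omega> i u w" "is_weak_partial \<Omega> i u' w'"
  shows "is_weak_partial \<Omega> i (\<lambda>s. a * u s + b * u' s) (\<lambda>s. a * w s + b * w' s)"
  unfolding is_weak_partial_def
proof (intro allI impI)
  fix \<phi> :: "'a \<Rightarrow> real"
  assume \<phi>: "test_function \<Omega> \<phi>"
  let ?M = "lebesgue_on \<Omega>" and ?d = "\<lambda>s. frechet_derivative \<phi> (at s) i"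
  note p = test_function_L2[OF assms(1) \<phi>] and d = test_function_derivative_L2[OF assms(1) \<phi> assms(2)]
  have lin: "(\<integral>s. (a * v s + b * v' s) * q s \<partial>?M) = a * (\<integral>s. v s * q s \<partial>?M) + b * (\<integral>s. v' s * q s \<partial>?M)"
    if "v \<in> L2 \<Omega>" "v' \<in> L2 \<Omega>" "q \<in> L2 \<Omega>" for v v' q
  proof -
    have "(\<integral>s. (a * v s + b * v' s) * q s \<partial>?M) = (\<integral>s. a * (v s * q s) + b * (v' s * q s) \<partial>?M)"
      by (simp add: algebra_simps)
    then show ?thesis
      using L2_mult_integrable[OF that(1,3)] L2_mult_integrable[OF that(2,3)] by simp
  qed
  have "(\<integral>s. u s * ?d s \<partial>?M) = - (\<integral>s. w s * \<phi> s \<partial>?M)" "(\<integral>s. u' s * ?d s \<partial>?M) = - (\<integral>s. w' s * \<phi> s \<partial>?M)"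
    using partial \<phi> unfolding is_weak_partial_def by blast+
  then show "(\<integral>s. (a * u s + b * u' s) * ?d s \<partial>?M) = - (\<integral>s. (a * w s + b * w' s) * \<phi> s \<partial>?M)"
    by (simp add: lin[OF u d] lin[OF w p])
qed

lemma
  assumes \<Omega>: "open \<Omega>" and uv: "u \<in> W12 \<Omega>" "v \<in> W12 \<Omega>"
  shows W12_lincomb: "(\<lambda>s. a * u s + b * v s) \<in> W12 \<Omega>"
    and weak_partial_lincomb: "i \<in> Basis \<Longrightarrow> eq_AE \<Omega> (weak_partial \<Omega> i (\<lambda>s. a * u s + b * v s))
      (\<lambda>s. a * weak_partial \<Omega> i u s + b * weak_partial \<Omega> i v s)"
proof -
  let ?w = "\<lambda>i s. a * weak_partial \<Omega> i u s + b * weak_partial \<Omega> i v s"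
  have w: "?w i \<in> L2 \<Omega>" "is_weak_partial \<Omega> i (\<lambda>s. a * u s + b * v s) (?w i)" if "i \<in> Basis" for i
  proof -
    note D = weak_partial_L2[OF uv(1) that] weak_partial_L2[OF uv(2) that]
    show "?w i \<in> L2 \<Omega>" by (rule L2_lincomb[OF D])
    show "is_weak_partial \<Omega> i (\<lambda>s. a * u s + b * v s) (?w i)"
      using \<Omega> by (intro is_weak_partial_lincomb[OF _ that] D uv[THEN W12_L2]
          weak_partial_is_weak_partial[OF uv(1) that] weak_partial_is_weak_partial[OF uv(2) that]) simp
  qed
  show W: "(\<lambda>s. a * u s + b * v s) \<in> W12 \<Omega>"
    unfolding W12_def using w L2_lincomb[OF uv[THEN W12_L2]] by blast
  show "eq_AE \<Omega> (weak_partial \<Omega> i (\<lambda>s. a * u s + b * v s)) (?w i)" if "i \<in> Basis"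
    by (rule weak_partial_unique[OF \<Omega> weak_partial_L2[OF W that] w(1)[OF that]
          weak_partial_is_weak_partial[OF W that] w(2)[OF that]])
qed

lemma W12_diff: "open \<Omega> \<Longrightarrow> u \<in> W12 \<Omega> \<Longrightarrow> v \<in> W12 \<Omega> \<Longrightarrow> (\<lambda>s. u s - v s) \<in> W12 \<Omega>"
  using W12_lincomb[of \<Omega> u v 1 "-1"] by simp

lemma W12_norm_nonneg: "0 \<le> W12_norm \<Omega> u"
  by (simp add: W12_norm_def sum_nonneg)

lemma W12_norm_sq:
  "(W12_norm \<Omega> u)\<^sup>2 = (L2_norm \<Omega> u)\<^sup>2 + (\<Sum>i\<in>Basis. (L2_norm \<Omega> (weak_partial \<Omega> i u))\<^sup>2)"
  by (simp add: W12_norm_def sum_nonneg)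

lemma W12_norm_lincomb_sq:
  assumes \<Omega>: "open \<Omega>" and uv: "u \<in> W12 \<Omega>" "v \<in> W12 \<Omega>"
  shows "(W12_norm \<Omega> (\<lambda>s. a * u s + b * v s))\<^sup>2 = (L2_norm \<Omega> (\<lambda>s. a * u s + b * v s))\<^sup>2
    + (\<Sum>i\<in>Basis. (L2_norm \<Omega> (\<lambda>s. a * weak_partial \<Omega> i u s + b * weak_partial \<Omega> i v s))\<^sup>2)"
proof -
  have "L2_norm \<Omega> (weak_partial \<Omega> i (\<lambda>s. a * u s + b * v s)) =
      L2_norm \<Omega> (\<lambda>s. a * weak_partial \<Omega> i u s + b * weak_partial \<Omega> i v s)" if "i \<in> Basis" for i
    by (intro L2_norm_cong_AE weak_partial_lincomb L2_lincomb weak_partial_L2 W12_lincomb that assms)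
  then show ?thesis by (simp add: W12_norm_sq)
qed

lemma W12_norm_diff_sq:
  assumes "open \<Omega>" "u \<in> W12 \<Omega>" "v \<in> W12 \<Omega>"
  shows "(W12_norm \<Omega> (\<lambda>s. u s - v s))\<^sup>2 = (L2_norm \<Omega> (\<lambda>s. u s - v s))\<^sup>2
    + (\<Sum>i\<in>Basis. (L2_norm \<Omega> (\<lambda>s. weak_partial \<Omega> i u s - weak_partial \<Omega> i v s))\<^sup>2)"
  using W12_norm_lincomb_sq[OF assms, of 1 "-1"] by simp

lemma W12_parallelogram:
  assumes "open \<Omega>" "u \<in> W12 \<Omega>" "v \<in> W12 \<Omega>"
  shows "(W12_norm \<Omega> (\<lambda>s. 1/2 * u s + 1/2 * v s))\<^sup>2 =
    1/2 * (W12_norm \<Omega> u)\<^sup>2 + 1/2 * (W12_norm \<Omega> v)\<^sup>2 - 1/4 * (W12_norm \<Omega> (\<lambda>s. u s - v s))\<^sup>2"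
proof -
  let ?p = "\<lambda>i. weak_partial \<Omega> i u" and ?q = "\<lambda>i. weak_partial \<Omega> i v"
  have "(\<Sum>i\<in>Basis. (L2_norm \<Omega> (\<lambda>s. 1/2 * ?p i s + 1/2 * ?q i s))\<^sup>2) =
      (\<Sum>i\<in>Basis. 1/2 * (L2_norm \<Omega> (?p i))\<^sup>2 + 1/2 * (L2_norm \<Omega> (?q i))\<^sup>2
        - 1/4 * (L2_norm \<Omega> (\<lambda>s. ?p i s - ?q i s))\<^sup>2)"
    by (intro sum.cong refl L2_parallelogram weak_partial_L2 assms)
  also have "\<dots> = 1/2 * (\<Sum>i\<in>Basis. (L2_norm \<Omega> (?p i))\<^sup>2) + 1/2 * (\<Sum>i\<in>Basis. (L2_norm \<Omega> (?q i))\<^sup>2)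
        - 1/4 * (\<Sum>i\<in>Basis. (L2_norm \<Omega> (\<lambda>s. ?p i s - ?q i s))\<^sup>2)"
    by (simp only: sum.distrib sum_subtractf sum_distrib_left)
  finally have sum_eq: "(\<Sum>i\<in>Basis. (L2_norm \<Omega> (\<lambda>s. 1/2 * ?p i s + 1/2 * ?q i s))\<^sup>2) = \<dots>" .
  show ?thesis
    unfolding W12_norm_lincomb_sq[OF assms, of "1/2" "1/2"] W12_norm_diff_sq[OF assms]
      W12_norm_sq[of \<Omega> u] W12_norm_sq[of \<Omega> v] sum_eq L2_parallelogram[OF assms(2,3)[THEN W12_L2]]
    by (simp add: algebra_simps)
qed

lemma W12_norm_minus_commute:
  assumes "open \<Omega>" "u \<in> W12 \<Omega>" "v \<in> W12 \<Omega>"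
  shows "W12_norm \<Omega> (\<lambda>s. u s - v s) = W12_norm \<Omega> (\<lambda>s. v s - u s)"
proof (rule power2_eq_imp_eq)
  show "(W12_norm \<Omega> (\<lambda>s. u s - v s))\<^sup>2 = (W12_norm \<Omega> (\<lambda>s. v s - u s))\<^sup>2"
    unfolding W12_norm_diff_sq[OF assms] W12_norm_diff_sq[OF assms(1,3,2)]
    by (simp add: L2_norm_minus_commute[of \<Omega> u] L2_norm_minus_commute[of \<Omega> "weak_partial \<Omega> i u" for i])
qed (simp_all add: W12_norm_nonneg)

lemma W12_zero: "(\<lambda>s. 0) \<in> W12 \<Omega>"
proof -
  have "is_weak_partial \<Omega> i (\<lambda>s. 0) (\<lambda>s. 0)" for i
    by (simp add: is_weak_partial_def)
  then show ?thesis
    unfolding W12_def using L2_zero[of \<Omega>] by blast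
qed

lemma W12_norm_zero: "open \<Omega> \<Longrightarrow> W12_norm \<Omega> (\<lambda>s. 0) = 0"
  using W12_norm_diff_sq[OF _ W12_zero W12_zero, of \<Omega>] by simp

lemma L2_norm_le_W12_norm: "L2_norm \<Omega> u \<le> W12_norm \<Omega> u"
  by (rule power2_le_imp_le) (simp_all add: W12_norm_sq W12_norm_nonneg sum_nonneg)

lemma L2_norm_weak_partial_diff_le:
  assumes "open \<Omega>" "u \<in> W12 \<Omega>" "v \<in> W12 \<Omega>" "i \<in> Basis"
  shows "L2_norm \<Omega> (\<lambda>s. weak_partial \<Omega> i u s - weak_partial \<Omega> i v s) \<le> W12_norm \<Omega> (\<lambda>s. u s - v s)"
proof (rule power2_le_imp_le)
  show "(L2_norm \<Omega> (\<lambda>s. weak_partial \<Omega> i u s - weak_partial \<Omega> i v s))\<^sup>2 \<le> (W12_norm \<Omega> (\<lambda>s. u s - v s))\<^sup>2"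
    unfolding W12_norm_diff_sq[OF assms(1-3)]
    using member_le_sum[OF assms(4), of "\<lambda>i. (L2_norm \<Omega> (\<lambda>s. weak_partial \<Omega> i u s - weak_partial \<Omega> i v s))\<^sup>2"]
    by (simp add: add_increasing)
qed (simp add: W12_norm_nonneg)

lemma L2_inner_tendsto:
  assumes "\<And>k. u k \<in> L2 \<Omega>" "v \<in> L2 \<Omega>" "q \<in> L2 \<Omega>" "L2_tendsto \<Omega> u v"
  shows "(\<lambda>k. \<integral>s. u k s * q s \<partial>lebesgue_on \<Omega>) \<longlonglongrightarrow> (\<integral>s. v s * q s \<partial>lebesgue_on \<Omega>)"
proof -
  have "(\<lambda>k. (\<integral>s. u k s * q s \<partial>lebesgue_on \<Omega>) - (\<integral>s. v s * q s \<partial>lebesgue_on \<Omega>)) \<longlonglongrightarrow> 0"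
  proof (rule Lim_null_comparison)
    have "(\<integral>s. u k s * q s \<partial>lebesgue_on \<Omega>) - (\<integral>s. v s * q s \<partial>lebesgue_on \<Omega>) =
        (\<integral>s. (u k s - v s) * q s \<partial>lebesgue_on \<Omega>)" for k
      using L2_mult_integrable[OF assms(1,3), of k] L2_mult_integrable[OF assms(2,3)]
      by (simp add: left_diff_distrib)
    then show "\<forall>\<^sub>F k in sequentially. norm ((\<integral>s. u k s * q s \<partial>lebesgue_on \<Omega>) - (\<integral>s. v s * q s \<partial>lebesgue_on \<Omega>))
        \<le> L2_norm \<Omega> (\<lambda>s. u k s - v s) * L2_norm \<Omega> q"
      using L2_Cauchy_Schwarz[OF L2_diff[OF assms(1,2)] assms(3)] by (simp add: always_eventually)
    show "(\<lambda>k. L2_norm \<Omega> (\<lambda>s. u k s - v s) * L2_norm \<Omega> q) \<longlonglongrightarrow> 0"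
      using assms(4) unfolding L2_tendsto_def by (rule tendsto_mult_left_zero)
  qed
  then show ?thesis by (simp only: LIM_zero_iff)
qed

text \<open>Weak differentiation is a closed operator in \<open>L\<^sup>2\<close>.\<close>

lemma is_weak_partial_limit:
  assumes "\<Omega> \<in> sets lebesgue" "i \<in> Basis"
    and "\<And>k. u k \<in> L2 \<Omega>" "v \<in> L2 \<Omega>" "L2_tendsto \<Omega> u v"
    and "\<And>k. w k \<in> L2 \<Omega>" "z \<in> L2 \<Omega>" "L2_tendsto \<Omega> w z"
    and partial: "\<And>k. is_weak_partial \<Omega> i (u k) (w k)"
  shows "is_weak_partial \<Omega> i v z"
  unfolding is_weak_partial_def
proof (intro allI impI)
  fix \<phi> :: "'a \<Rightarrow> real"
  assume \<phi>: "test_function \<Omega> \<phi>"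
  let ?M = "lebesgue_on \<Omega>" and ?d = "\<lambda>s. frechet_derivative \<phi> (at s) i"
  have "(\<lambda>k. \<integral>s. u k s * ?d s \<partial>?M) \<longlonglongrightarrow> (\<integral>s. v s * ?d s \<partial>?M)"
    by (rule L2_inner_tendsto[OF assms(3,4) test_function_derivative_L2[OF assms(1) \<phi> assms(2)] assms(5)])
  moreover have "(\<lambda>k. - (\<integral>s. w k s * \<phi> s \<partial>?M)) \<longlonglongrightarrow> - (\<integral>s. z s * \<phi> s \<partial>?M)"
    by (rule tendsto_minus[OF L2_inner_tendsto[OF assms(6,7) test_function_L2[OF assms(1) \<phi>] assms(8)]])
  moreover have "(\<integral>s. u k s * ?d s \<partial>?M) = - (\<integral>s. w k s * \<phi> s \<partial>?M)" for k
    using partial \<phi> unfolding is_weak_partial_def by blast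
  ultimately show "(\<integral>s. v s * ?d s \<partial>?M) = - (\<integral>s. z s * \<phi> s \<partial>?M)"
    by (simp add: LIMSEQ_unique)
qed

theorem W12_complete:
  assumes \<Omega>: "open \<Omega>" and u: "\<And>k. u k \<in> W12 \<Omega>"
    and Cauchy: "((\<lambda>(k, l). W12_norm \<Omega> (\<lambda>s. u k s - u l s)) \<longlongrightarrow> 0) (sequentially \<times>\<^sub>F sequentially)"
  shows "\<exists>v\<in>W12 \<Omega>. W12_tendsto \<Omega> u v"
proof -
  have \<Omega>_meas: "\<Omega> \<in> sets lebesgue" using \<Omega> by simp
  have "((\<lambda>(k, l). L2_norm \<Omega> (\<lambda>s. u k s - u l s)) \<longlongrightarrow> 0) (sequentially \<times>\<^sub>F sequentially)"
    by (rule Lim_null_comparison[OF always_eventually Cauchy])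
       (auto simp: L2_norm_nonneg L2_norm_le_W12_norm)
  then obtain v where v: "v \<in> L2 \<Omega>" "L2_tendsto \<Omega> u v"
    using L2_complete[of u \<Omega>, OF W12_L2[OF u]] by blast
  have "\<exists>z\<in>L2 \<Omega>. L2_tendsto \<Omega> (\<lambda>k. weak_partial \<Omega> i (u k)) z" if i: "i \<in> Basis" for i
  proof (rule L2_complete)
    show "weak_partial \<Omega> i (u k) \<in> L2 \<Omega>" for k by (rule weak_partial_L2[OF u i])
    show "((\<lambda>(k, l). L2_norm \<Omega> (\<lambda>s. weak_partial \<Omega> i (u k) s - weak_partial \<Omega> i (u l) s)) \<longlongrightarrow> 0)
        (sequentially \<times>\<^sub>F sequentially)"
      by (rule Lim_null_comparison[OF always_eventually Cauchy])
         (auto simp: L2_norm_nonneg intro: L2_norm_weak_partial_diff_le[OF \<Omega> u u i])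
  qed
  then obtain z where z: "\<And>i. i \<in> Basis \<Longrightarrow> z i \<in> L2 \<Omega>"
    "\<And>i. i \<in> Basis \<Longrightarrow> L2_tendsto \<Omega> (\<lambda>k. weak_partial \<Omega> i (u k)) (z i)"
    by metis
  have zp: "is_weak_partial \<Omega> i v (z i)" if i: "i \<in> Basis" for i
    by (rule is_weak_partial_limit[OF \<Omega>_meas i W12_L2[OF u] v weak_partial_L2[OF u i] z(1)[OF i] z(2)[OF i]
          weak_partial_is_weak_partial[OF u i]])
  have vW: "v \<in> W12 \<Omega>" unfolding W12_def using v(1) z(1) zp by blast
  have "L2_norm \<Omega> (\<lambda>s. weak_partial \<Omega> i (u k) s - weak_partial \<Omega> i v s) =
      L2_norm \<Omega> (\<lambda>s. weak_partial \<Omega> i (u k) s - z i s)" if i: "i \<in> Basis" for i k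
  proof (rule L2_norm_cong_AE)
    have "eq_AE \<Omega> (weak_partial \<Omega> i v) (z i)"
      by (rule weak_partial_unique[OF \<Omega> weak_partial_L2[OF vW i] z(1)[OF i]
            weak_partial_is_weak_partial[OF vW i] zp[OF i]])
    then show "eq_AE \<Omega> (\<lambda>s. weak_partial \<Omega> i (u k) s - weak_partial \<Omega> i v s)
        (\<lambda>s. weak_partial \<Omega> i (u k) s - z i s)"
      unfolding eq_AE_def by eventually_elim simp
  qed (intro L2_diff weak_partial_L2 u vW z(1) i)+
  then have norm_sq: "(W12_norm \<Omega> (\<lambda>s. u k s - v s))\<^sup>2 = (L2_norm \<Omega> (\<lambda>s. u k s - v s))\<^sup>2
      + (\<Sum>i\<in>Basis. (L2_norm \<Omega> (\<lambda>s. weak_partial \<Omega> i (u k) s - z i s))\<^sup>2)" for k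
    by (simp add: W12_norm_diff_sq[OF \<Omega> u vW])
  have "(\<lambda>k. sqrt ((W12_norm \<Omega> (\<lambda>s. u k s - v s))\<^sup>2)) \<longlonglongrightarrow> sqrt (0\<^sup>2 + (\<Sum>i\<in>(Basis::'a set). 0\<^sup>2))"
    unfolding norm_sq using v(2) z(2) unfolding L2_tendsto_def by (intro tendsto_intros)
  then have "W12_tendsto \<Omega> u v"
    by (simp add: W12_tendsto_def W12_norm_nonneg)
  then show ?thesis using vW by blast
qed

lemma W12_tendsto_imp_L2_tendsto: "W12_tendsto \<Omega> u v \<Longrightarrow> L2_tendsto \<Omega> u v"
  unfolding W12_tendsto_def L2_tendsto_def
  by (rule Lim_null_comparison[OF always_eventually]) (auto simp: L2_norm_nonneg L2_norm_le_W12_norm)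

lemma W12_norm_diff_sq_tendsto:
  assumes \<Omega>: "open \<Omega>" and f: "f \<in> W12 \<Omega>" and u: "\<And>k. u k \<in> W12 \<Omega>" and v: "v \<in> W12 \<Omega>"
    and lim: "W12_tendsto \<Omega> u v"
  shows "(\<lambda>k. (W12_norm \<Omega> (\<lambda>s. f s - u k s))\<^sup>2) \<longlonglongrightarrow> (W12_norm \<Omega> (\<lambda>s. f s - v s))\<^sup>2"
proof -
  have *: "(\<lambda>k. L2_norm \<Omega> (\<lambda>s. p s - q k s)) \<longlonglongrightarrow> L2_norm \<Omega> (\<lambda>s. p s - r s)"
    if "p \<in> L2 \<Omega>" "\<And>k. q k \<in> L2 \<Omega>" "r \<in> L2 \<Omega>"
      and le: "\<And>k. L2_norm \<Omega> (\<lambda>s. q k s - r s) \<le> W12_norm \<Omega> (\<lambda>s. u k s - v s)" for p q r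
  proof (rule L2_norm_tendsto)
    show "(\<lambda>k. L2_norm \<Omega> (\<lambda>s. (p s - q k s) - (p s - r s))) \<longlonglongrightarrow> 0"
    proof (rule Lim_null_comparison[OF always_eventually])
      show "(\<lambda>k. W12_norm \<Omega> (\<lambda>s. u k s - v s)) \<longlonglongrightarrow> 0"
        using lim by (simp add: W12_tendsto_def)
      show "\<forall>k. norm (L2_norm \<Omega> (\<lambda>s. (p s - q k s) - (p s - r s))) \<le> W12_norm \<Omega> (\<lambda>s. u k s - v s)"
        using le by (simp add: L2_norm_nonneg L2_norm_minus_commute[of \<Omega> r])
    qed
  qed (intro L2_diff that)+
  show ?thesis
    unfolding W12_norm_diff_sq[OF \<Omega> f u] W12_norm_diff_sq[OF \<Omega> f v]
    by (intro tendsto_intros * W12_L2 weak_partial_L2 f u v L2_norm_le_W12_norm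
        L2_norm_weak_partial_diff_le[OF \<Omega>])
qed

section \<open>The outer problem\<close>

text \<open>The outer problem, with the inner problem as constraint.\<close>

locale outer_problem = inner_problem +
  fixes f :: "'a \<Rightarrow> real" and \<beta> :: real
  assumes \<Omega>: "open \<Omega>" and embedding: "compact_embedding_W12_L2 \<Omega>"
    and f: "f \<in> W12 \<Omega>" and \<beta>: "\<beta> > 0"
begin

text \<open>The data fit \<open>1/2 \<parallel>T f x\<^sub>g - y\<parallel>\<^sup>2\<close> in the outer objective, as a function of \<open>y\<close> and \<open>g\<close>.\<close>

definition outer_fit :: "('a \<Rightarrow> real) \<Rightarrow> ('a \<Rightarrow> real) \<Rightarrow> real" where
  "outer_fit y g = data_fit y f (inner_minimizer \<Omega> T R \<alpha> y g)"

lemma outer_fit_nonneg: "0 \<le> outer_fit y g"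
  by (simp add: outer_fit_def data_fit_nonneg)

lemma outer_fit_tendsto:
  assumes "\<And>i. y i \<in> L2 \<Omega>" "y0 \<in> L2 \<Omega>" "((\<lambda>i. L2_norm \<Omega> (\<lambda>s. y i s - y0 s)) \<longlongrightarrow> 0) F"
    and "\<And>i. g i \<in> L2 \<Omega>" "g0 \<in> L2 \<Omega>" "((\<lambda>i. L2_norm \<Omega> (\<lambda>s. g i s - g0 s)) \<longlongrightarrow> 0) F"
  shows "((\<lambda>i. outer_fit (y i) (g i)) \<longlongrightarrow> outer_fit y0 g0) F"
  unfolding outer_fit_def by (rule outer_data_fit_continuous[OF W12_L2[OF f] assms])

lemma ADP_solution_iff:
  "ADP_solution \<Omega> T R \<alpha> \<beta> f y g \<longleftrightarrow> g \<in> W12 \<Omega> \<and>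
    (\<forall>h\<in>W12 \<Omega>. outer_fit y g + \<beta> * (W12_norm \<Omega> (\<lambda>s. f s - g s))\<^sup>2
      \<le> outer_fit y h + \<beta> * (W12_norm \<Omega> (\<lambda>s. f s - h s))\<^sup>2)"
  by (auto simp: ADP_solution_def is_arg_min_linorder outer_objective_def outer_fit_def data_fit_def)

lemma ADP_solution_W12: "ADP_solution \<Omega> T R \<alpha> \<beta> f y g \<Longrightarrow> g \<in> W12 \<Omega>"
  by (simp add: ADP_solution_iff)

lemma ADP_solution_le:
  "ADP_solution \<Omega> T R \<alpha> \<beta> f y g \<Longrightarrow> h \<in> W12 \<Omega> \<Longrightarrow>
    outer_fit y g + \<beta> * (W12_norm \<Omega> (\<lambda>s. f s - g s))\<^sup>2
      \<le> outer_fit y h + \<beta> * (W12_norm \<Omega> (\<lambda>s. f s - h s))\<^sup>2"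
  by (simp add: ADP_solution_iff)

text \<open>Solutions are bounded in \<open>W\<^bsup>1,2\<^esup>\<close> by comparison with the competitor \<open>f\<close>.\<close>

lemma ADP_solutions_bounded:
  assumes y: "\<And>k. y k \<in> L2 \<Omega>" "y_hat \<in> L2 \<Omega>" "L2_tendsto \<Omega> y y_hat"
    and sol: "\<And>k. ADP_solution \<Omega> T R \<alpha> \<beta> f (y k) (g k)"
  shows "bounded (range (\<lambda>k. W12_norm \<Omega> (g k)))"
proof -
  note gW = ADP_solution_W12[OF sol]
  have "(\<lambda>k. outer_fit (y k) f) \<longlonglongrightarrow> outer_fit y_hat f"
    using y W12_L2[OF f] unfolding L2_tendsto_def by (intro outer_fit_tendsto) simp_all
  then have "Bseq (\<lambda>k. outer_fit (y k) f)" using convergentI convergent_imp_Bseq by blast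
  then obtain K where K: "\<And>k. \<bar>outer_fit (y k) f\<bar> \<le> K"
    by (auto simp: Bseq_def)
  have "\<bar>W12_norm \<Omega> (g k)\<bar> \<le> sqrt (2 * (W12_norm \<Omega> f)\<^sup>2 + 2 * (K / \<beta>))" for k
  proof -
    have "\<beta> * (W12_norm \<Omega> (\<lambda>s. f s - g k s))\<^sup>2 \<le> K"
      using ADP_solution_le[OF sol f, of k] K[of k] outer_fit_nonneg[of "y k" "g k"]
      by (simp add: W12_norm_zero[OF \<Omega>])
    then have "(W12_norm \<Omega> (\<lambda>s. f s - g k s))\<^sup>2 \<le> K / \<beta>"
      using \<beta> by (simp add: pos_le_divide_eq mult.commute)
    moreover have "1/4 * (W12_norm \<Omega> (g k))\<^sup>2 \<le>
        1/2 * (W12_norm \<Omega> f)\<^sup>2 + 1/2 * (W12_norm \<Omega> (\<lambda>s. f s - g k s))\<^sup>2"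
      using W12_parallelogram[OF \<Omega> f W12_diff[OF \<Omega> f gW], of k]
        zero_le_power2[of "W12_norm \<Omega> (\<lambda>s. 1/2 * f s + 1/2 * (f s - g k s))"] by simp
    ultimately have "(W12_norm \<Omega> (g k))\<^sup>2 \<le> 2 * (W12_norm \<Omega> f)\<^sup>2 + 2 * (K / \<beta>)"
      by linarith
    then show ?thesis
      by (simp add: W12_norm_nonneg real_le_rsqrt)
  qed
  then show ?thesis by (auto simp: bounded_iff)
qed

text \<open>Comparing two solutions with their midpoint: the parallelogram law turns \<open>L\<^sup>2\<close> continuity of
  the data fit into an estimate of the \<open>W\<^bsup>1,2\<^esup>\<close> distance.\<close>

lemma ADP_solutions_midpoint:
  assumes "ADP_solution \<Omega> T R \<alpha> \<beta> f y g" "ADP_solution \<Omega> T R \<alpha> \<beta> f y' g'"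
  defines "h \<equiv> \<lambda>s. 1/2 * g s + 1/2 * g' s"
  shows "\<beta> / 2 * (W12_norm \<Omega> (\<lambda>s. g s - g' s))\<^sup>2 \<le>
    (outer_fit y h - outer_fit y g) + (outer_fit y' h - outer_fit y' g')"
proof -
  note W = assms(1,2)[THEN ADP_solution_W12]
  have hW: "h \<in> W12 \<Omega>" unfolding h_def by (rule W12_lincomb[OF \<Omega> W])
  have "(\<lambda>s. f s - h s) = (\<lambda>s. 1/2 * (f s - g s) + 1/2 * (f s - g' s))"
    by (simp add: h_def fun_eq_iff field_simps)
  moreover have "(\<lambda>s. (f s - g s) - (f s - g' s)) = (\<lambda>s. g' s - g s)"
    by simp
  ultimately have eq: "(W12_norm \<Omega> (\<lambda>s. f s - h s))\<^sup>2 = 1/2 * (W12_norm \<Omega> (\<lambda>s. f s - g s))\<^sup>2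
      + 1/2 * (W12_norm \<Omega> (\<lambda>s. f s - g' s))\<^sup>2 - 1/4 * (W12_norm \<Omega> (\<lambda>s. g s - g' s))\<^sup>2"
    using W12_parallelogram[OF \<Omega> W12_diff[OF \<Omega> f W(1)] W12_diff[OF \<Omega> f W(2)]]
      W12_norm_minus_commute[OF \<Omega> W] by simp
  have "2 * (\<beta> * (W12_norm \<Omega> (\<lambda>s. f s - h s))\<^sup>2) = \<beta> * (W12_norm \<Omega> (\<lambda>s. f s - g s))\<^sup>2
      + \<beta> * (W12_norm \<Omega> (\<lambda>s. f s - g' s))\<^sup>2 - \<beta> / 2 * (W12_norm \<Omega> (\<lambda>s. g s - g' s))\<^sup>2"
    unfolding eq by (simp add: algebra_simps)
  then show ?thesis
    using ADP_solution_le[OF assms(1) hW] ADP_solution_le[OF assms(2) hW] by linarith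
qed

text \<open>Along a subsequence converging in \<open>L\<^sup>2\<close>, all data fits in the midpoint estimate have the same
  limit, so the subsequence is Cauchy in \<open>W\<^bsup>1,2\<^esup>\<close>.\<close>

theorem ADP_solutions_subsequence:
  assumes y: "\<And>k. y k \<in> L2 \<Omega>" "y_hat \<in> L2 \<Omega>" "L2_tendsto \<Omega> y y_hat"
    and sol: "\<And>k. ADP_solution \<Omega> T R \<alpha> \<beta> f (y k) (g k)"
  shows "\<exists>r g_hat. strict_mono r \<and> g_hat \<in> W12 \<Omega> \<and> W12_tendsto \<Omega> (\<lambda>k. g (r k)) g_hat"
proof -
  note gW = ADP_solution_W12[OF sol]
  obtain r v where r: "strict_mono r" and v: "v \<in> L2 \<Omega>" and lim: "L2_tendsto \<Omega> (\<lambda>k. g (r k)) v"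
  proof -
    have "(\<forall>k. g k \<in> W12 \<Omega>) \<and> bounded (range (\<lambda>k. W12_norm \<Omega> (g k)))"
      using gW ADP_solutions_bounded[OF y sol] by simp
    with embedding have "\<exists>r v. strict_mono r \<and> v \<in> L2 \<Omega> \<and> L2_tendsto \<Omega> (\<lambda>k. g (r k)) v"
      unfolding compact_embedding_W12_L2_def by (elim allE[of _ g] mp)
    then show thesis using that by (elim exE conjE)
  qed
  let ?P = "sequentially \<times>\<^sub>F sequentially :: (nat \<times> nat) filter"
  let ?h = "\<lambda>p s. 1/2 * g (r (fst p)) s + 1/2 * g (r (snd p)) s"
  have gL: "g (r k) \<in> L2 \<Omega>" for k by (rule W12_L2[OF gW])
  have ylim: "(\<lambda>k. L2_norm \<Omega> (\<lambda>s. y (r k) s - y_hat s)) \<longlonglongrightarrow> 0"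
    using LIMSEQ_subseq_LIMSEQ[OF y(3)[unfolded L2_tendsto_def] r] by (simp add: o_def)
  note glim = lim[unfolded L2_tendsto_def]
  have comp: "((\<lambda>p. a (fst p)) \<longlongrightarrow> 0) ?P" "((\<lambda>p. a (snd p)) \<longlongrightarrow> 0) ?P" if "a \<longlonglongrightarrow> 0" for a :: "nat \<Rightarrow> real"
    using filterlim_compose[OF that filterlim_fst] filterlim_compose[OF that filterlim_snd] by auto
  have hlim: "((\<lambda>p. L2_norm \<Omega> (\<lambda>s. ?h p s - v s)) \<longlongrightarrow> 0) ?P"
  proof (rule Lim_null_comparison)
    show "\<forall>\<^sub>F p in ?P. norm (L2_norm \<Omega> (\<lambda>s. ?h p s - v s)) \<le>
        1/2 * L2_norm \<Omega> (\<lambda>s. g (r (fst p)) s - v s) + 1/2 * L2_norm \<Omega> (\<lambda>s. g (r (snd p)) s - v s)"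
    proof (intro always_eventually allI)
      fix p :: "nat \<times> nat"
      have eq: "(\<lambda>s. ?h p s - v s) = (\<lambda>s. 1/2 * (g (r (fst p)) s - v s) + 1/2 * (g (r (snd p)) s - v s))"
        by (simp add: fun_eq_iff field_simps)
      have "L2_norm \<Omega> (\<lambda>s. ?h p s - v s) \<le>
          L2_norm \<Omega> (\<lambda>s. 1/2 * (g (r (fst p)) s - v s)) + L2_norm \<Omega> (\<lambda>s. 1/2 * (g (r (snd p)) s - v s))"
        unfolding eq by (intro L2_norm_triangle L2_cmult L2_diff gL v)
      then show "norm (L2_norm \<Omega> (\<lambda>s. ?h p s - v s)) \<le>
        1/2 * L2_norm \<Omega> (\<lambda>s. g (r (fst p)) s - v s) + 1/2 * L2_norm \<Omega> (\<lambda>s. g (r (snd p)) s - v s)"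
        unfolding L2_norm_cmult by (simp add: L2_norm_nonneg)
    qed
    show "((\<lambda>p. 1/2 * L2_norm \<Omega> (\<lambda>s. g (r (fst p)) s - v s) + 1/2 * L2_norm \<Omega> (\<lambda>s. g (r (snd p)) s - v s)) \<longlongrightarrow> 0) ?P"
      by (intro tendsto_add_zero tendsto_mult_right_zero comp[OF glim])
  qed
  let ?rhs = "\<lambda>p. (outer_fit (y (r (fst p))) (?h p) - outer_fit (y (r (fst p))) (g (r (fst p))))
    + (outer_fit (y (r (snd p))) (?h p) - outer_fit (y (r (snd p))) (g (r (snd p))))"
  have "((\<lambda>p. sqrt (2 / \<beta> * ?rhs p)) \<longlongrightarrow> sqrt (2 / \<beta> * ((outer_fit y_hat v - outer_fit y_hat v)
      + (outer_fit y_hat v - outer_fit y_hat v)))) ?P"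
    by (intro tendsto_intros outer_fit_tendsto y gL v hlim L2_lincomb comp[OF ylim] comp[OF glim])
  then have rhs: "((\<lambda>p. sqrt (2 / \<beta> * ?rhs p)) \<longlongrightarrow> 0) ?P" by simp
  have "((\<lambda>(k, l). W12_norm \<Omega> (\<lambda>s. g (r k) s - g (r l) s)) \<longlongrightarrow> 0) ?P"
  proof (rule Lim_null_comparison[OF always_eventually rhs], rule allI)
    fix p :: "nat \<times> nat"
    have "(W12_norm \<Omega> (\<lambda>s. g (r (fst p)) s - g (r (snd p)) s))\<^sup>2 \<le> 2 / \<beta> * ?rhs p"
      using ADP_solutions_midpoint[OF sol[of "r (fst p)"] sol[of "r (snd p)"]] \<beta>
      by (simp add: field_simps)
    then have "W12_norm \<Omega> (\<lambda>s. g (r (fst p)) s - g (r (snd p)) s) \<le> sqrt (2 / \<beta> * ?rhs p)"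
      by (rule real_le_rsqrt)
    then show "norm (case p of (k, l) \<Rightarrow> W12_norm \<Omega> (\<lambda>s. g (r k) s - g (r l) s)) \<le> sqrt (2 / \<beta> * ?rhs p)"
      by (simp add: case_prod_beta W12_norm_nonneg)
  qed
  then obtain g_hat where "g_hat \<in> W12 \<Omega>" "W12_tendsto \<Omega> (\<lambda>k. g (r k)) g_hat"
    using W12_complete[of \<Omega> "\<lambda>k. g (r k)", OF \<Omega> gW] by blast
  with r show ?thesis by blast
qed

theorem ADP_solution_limit:
  assumes y: "\<And>k. y k \<in> L2 \<Omega>" "y_hat \<in> L2 \<Omega>" "L2_tendsto \<Omega> y y_hat"
    and sol: "\<And>k. ADP_solution \<Omega> T R \<alpha> \<beta> f (y k) (g k)"
    and g_hat: "g_hat \<in> W12 \<Omega>" and lim: "W12_tendsto \<Omega> g g_hat"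
  shows "ADP_solution \<Omega> T R \<alpha> \<beta> f y_hat g_hat"
  unfolding ADP_solution_iff
proof (intro conjI ballI)
  fix h assume h: "h \<in> W12 \<Omega>"
  note gW = ADP_solution_W12[OF sol]
  note ylim = y(3)[unfolded L2_tendsto_def]
  note glim = W12_tendsto_imp_L2_tendsto[OF lim, unfolded L2_tendsto_def]
  have "(\<lambda>k. outer_fit (y k) (g k) + \<beta> * (W12_norm \<Omega> (\<lambda>s. f s - g k s))\<^sup>2) \<longlonglongrightarrow>
      outer_fit y_hat g_hat + \<beta> * (W12_norm \<Omega> (\<lambda>s. f s - g_hat s))\<^sup>2"
    by (intro tendsto_add tendsto_mult tendsto_const outer_fit_tendsto y(1,2) ylim glim
        W12_L2 gW g_hat W12_norm_diff_sq_tendsto[OF \<Omega> f gW g_hat lim])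
  moreover have "(\<lambda>k. outer_fit (y k) h + \<beta> * (W12_norm \<Omega> (\<lambda>s. f s - h s))\<^sup>2) \<longlonglongrightarrow>
      outer_fit y_hat h + \<beta> * (W12_norm \<Omega> (\<lambda>s. f s - h s))\<^sup>2"
    using W12_L2[OF h] by (intro tendsto_add tendsto_const outer_fit_tendsto y(1,2) ylim) simp_all
  ultimately show "outer_fit y_hat g_hat + \<beta> * (W12_norm \<Omega> (\<lambda>s. f s - g_hat s))\<^sup>2 \<le>
      outer_fit y_hat h + \<beta> * (W12_norm \<Omega> (\<lambda>s. f s - h s))\<^sup>2"
    by (rule LIMSEQ_le) (use ADP_solution_le[OF sol h] in blast)
qed (rule g_hat)

end

section \<open>Stability of solutions\<close>

theorem theorem3p11:
  fixes \<Omega> :: "(real ^ 'n) set"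
    and T :: "(real ^ 'n \<Rightarrow> real) \<Rightarrow> (real ^ 'n \<Rightarrow> real) \<Rightarrow> (real ^ 'n \<Rightarrow> real)"
    and R :: "(real ^ 'n \<Rightarrow> real) \<Rightarrow> ennreal"
    and f y_hat :: "real ^ 'n \<Rightarrow> real"
    and y g :: "nat \<Rightarrow> real ^ 'n \<Rightarrow> real"
    and \<alpha> \<beta> :: real
  assumes "open \<Omega>"
    and "compact_embedding_W12_L2 \<Omega>"
    and "L2_bounded_bilinear \<Omega> T"
    and "f \<in> W12 \<Omega>"
    and "\<alpha> > 0" and "\<beta> > 0"
    and "L2_functional \<Omega> R"
    and "L2_strongly_convex \<Omega> R"
    and "L2_coercive \<Omega> R"
    and "L2_weakly_lsc \<Omega> R"
    and "\<exists>x\<in>L2 \<Omega>. R x \<noteq> \<infinity>"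
    and "\<And>k. y k \<in> L2 \<Omega>" and "y_hat \<in> L2 \<Omega>" and "L2_tendsto \<Omega> y y_hat"
    and "\<And>k. ADP_solution \<Omega> T R \<alpha> \<beta> f (y k) (g k)"
  shows "(\<exists>r g_hat. strict_mono r \<and> g_hat \<in> W12 \<Omega> \<and> W12_tendsto \<Omega> (\<lambda>k. g (r k)) g_hat) \<and>
         (\<forall>r g_hat. strict_mono r \<and> g_hat \<in> W12 \<Omega> \<and> W12_tendsto \<Omega> (\<lambda>k. g (r k)) g_hat \<longrightarrow>
            ADP_solution \<Omega> T R \<alpha> \<beta> f y_hat g_hat)"
proof -
  interpret outer_problem \<Omega> T R \<alpha> f \<beta>
    by unfold_locales (use assms in simp_all)
  note y = assms(12-14) and sol = assms(15)
  have "ADP_solution \<Omega> T R \<alpha> \<beta> f y_hat g_hat"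
    if r: "strict_mono r" and g_hat: "g_hat \<in> W12 \<Omega>" and lim: "W12_tendsto \<Omega> (\<lambda>k. g (r k)) g_hat" for r g_hat
  proof (rule ADP_solution_limit[OF y(1) y(2) _ sol g_hat lim])
    show "L2_tendsto \<Omega> (\<lambda>k. y (r k)) y_hat"
      using LIMSEQ_subseq_LIMSEQ[OF y(3)[unfolded L2_tendsto_def] r]
      by (simp add: L2_tendsto_def o_def)
  qed
  then show ?thesis
    using ADP_solutions_subsequence[OF y sol] by blast
qed

end
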